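(* Let $n \geq 2$, $A = \{0,1,\ldots,n-1\}$ and let $d \geq 1$ be an integer. Every normal amenable subgroup of $\operatorname{Aut}(A^{\mathbb{Z}^d})$ is contained in $\Sigma(A^{\mathbb{Z}^d})$.
   Context: $A^{\mathbb{Z}^d}$ carries the product topology of the discrete finite set $A$. For $v \in \mathbb{Z}^d$, the shift by $v$ is the homeomorphism $\sigma_v$ of $A^{\mathbb{Z}^d}$ given by $(\sigma_v x)_u = x_{u+v}$. $\Sigma(A^{\mathbb{Z}^d}) = \{\sigma_v : v \in \mathbb{Z}^d\}$ is the group of all shifts, generated by the $d$ coordinate shifts. $\operatorname{Aut}(A^{\mathbb{Z}^d})$ is the group (under composition) of all homeomorphisms of $A^{\mathbb{Z}^d}$ that commute with every element of $\Sigma(A^{\mathbb{Z}^d})$. Amenability is that of discrete groups. *)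

theory Defs
  imports "HOL-Analysis.Analysis" "HOL-Algebra.Coset" "HOL-Algebra.Bij"
begin

text \<open>
  The lattice of rank d is rendered as \<^typ>\<open>int ^ 'd\<close>, the rank being the cardinality of the finite
  (hence nonempty) index type. The alphabet is the set \<^term>\<open>{..<n :: nat}\<close>.
\<close>

definition full_shift_topology :: "nat \<Rightarrow> (int ^ 'd::finite \<Rightarrow> nat) topology" where
  "full_shift_topology n = product_topology (\<lambda>_. discrete_topology {..<n}) UNIV"

definition full_shift :: "nat \<Rightarrow> (int ^ 'd::finite \<Rightarrow> nat) set" where
  "full_shift n = topspace (full_shift_topology n)"

text \<open>
  Self-maps of the full shift are taken to be extensional, i.e. \<^const>\<open>undefined\<close> outside of it,
  so that equality of such functions is equality of maps on the full shift; this is also the convention of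
  \<^const>\<open>BijGroup\<close>.
\<close>

definition shift :: "nat \<Rightarrow> int ^ 'd::finite \<Rightarrow> (int ^ 'd \<Rightarrow> nat) \<Rightarrow> (int ^ 'd \<Rightarrow> nat)" where
  "shift n v = (\<lambda>x \<in> full_shift n. \<lambda>u. x (u + v))"

definition shifts :: "nat \<Rightarrow> ((int ^ 'd::finite \<Rightarrow> nat) \<Rightarrow> (int ^ 'd \<Rightarrow> nat)) set" where
  "shifts n = range (shift n)"

definition shift_automorphisms :: "nat \<Rightarrow> ((int ^ 'd::finite \<Rightarrow> nat) \<Rightarrow> (int ^ 'd \<Rightarrow> nat)) set" where
  "shift_automorphisms n =
    {f \<in> extensional (full_shift n).
       homeomorphic_map (full_shift_topology n) (full_shift_topology n) f \<and>
       (\<forall>s \<in> shifts n. compose (full_shift n) f s = compose (full_shift n) s f)}"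

definition shift_aut_group :: "nat \<Rightarrow> ((int ^ 'd::finite \<Rightarrow> nat) \<Rightarrow> (int ^ 'd \<Rightarrow> nat)) monoid" where
  "shift_aut_group n = BijGroup (full_shift n) \<lparr>carrier := shift_automorphisms n\<rparr>"

text \<open>
  A discrete group is amenable if it carries a left-invariant finitely additive probability
  measure defined on all of its subsets.
\<close>

definition amenable :: "('a, 'b) monoid_scheme \<Rightarrow> bool" where
  "amenable G \<longleftrightarrow> group G \<and>
    (\<exists>\<mu> :: 'a set \<Rightarrow> real.
       (\<forall>S \<subseteq> carrier G. 0 \<le> \<mu> S) \<and>
       \<mu> (carrier G) = 1 \<and>
       (\<forall>S \<subseteq> carrier G. \<forall>T \<subseteq> carrier G. S \<inter> T = {} \<longrightarrow> \<mu> (S \<union> T) = \<mu> S + \<mu> T) \<and>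
       (\<forall>g \<in> carrier G. \<forall>S \<subseteq> carrier G. \<mu> (g <#\<^bsub>G\<^esub> S) = \<mu> S))"

lemma full_shift_iff: "x \<in> full_shift n \<longleftrightarrow> (\<forall>u. x u < n)"
  by (auto simp: full_shift_def full_shift_topology_def PiE_iff)

lemma shift_automorphisms_subset_Bij: "shift_automorphisms n \<subseteq> Bij (full_shift n)"
  by (auto simp: shift_automorphisms_def Bij_def full_shift_def bij_betw_def
      dest: homeomorphic_imp_surjective_map homeomorphic_imp_injective_map)

lemma shift_in_Bij: "shift n v \<in> Bij (full_shift n)"
proof -
  have "bij_betw (shift n v) (full_shift n) (full_shift n)"
    by (rule bij_betw_byWitness[where f' = "shift n (- v)"])
      (auto simp: shift_def full_shift_iff)
  then show ?thesis
    by (simp add: Bij_def shift_def)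
qed

lemma homeomorphic_map_shift:
  "homeomorphic_map (full_shift_topology n) (full_shift_topology n) (shift n v)"
proof -
  have cont: "continuous_map (full_shift_topology n) (full_shift_topology n) (shift n w)"
    for w :: "int ^ 'd::finite"
  proof -
    have "continuous_map (full_shift_topology n) (full_shift_topology n)
            (\<lambda>x (u :: int ^ 'd). x (u + w))"
      unfolding full_shift_topology_def
      by (rule continuous_map_coordinatewise_then_product)
        (auto intro!: continuous_map_product_coordinates)
    then show ?thesis
      by (rule continuous_map_eq) (simp add: shift_def full_shift_def)
  qed
  have "homeomorphic_maps (full_shift_topology n) (full_shift_topology n)
          (shift n v) (shift n (- v))"
    unfolding homeomorphic_maps_def
    by (auto simp: cont simp flip: full_shift_def) (auto simp: shift_def full_shift_iff)
  then show ?thesis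
    by (rule homeomorphic_maps_imp_map)
qed

lemma shifts_subset_automorphisms: "shifts n \<subseteq> shift_automorphisms n"
  by (auto simp: shifts_def shift_automorphisms_def homeomorphic_map_shift)
    (auto simp: shift_def compose_def full_shift_iff fun_eq_iff algebra_simps)

lemma subgroup_shift_automorphisms:
  "subgroup (shift_automorphisms n) (BijGroup (full_shift n :: (int ^ 'd::finite \<Rightarrow> nat) set))"
proof -
  let ?X = "full_shift n :: (int ^ 'd::finite \<Rightarrow> nat) set"
  let ?T = "full_shift_topology n :: (int ^ 'd \<Rightarrow> nat) topology"
  let ?A = "shift_automorphisms n :: ((int ^ 'd \<Rightarrow> nat) \<Rightarrow> _) set"
  interpret B: group "BijGroup ?X" by (rule group_BijGroup)
  have carrier: "carrier (BijGroup ?X) = Bij ?X"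
    by (simp add: BijGroup_def)
  have mult: "f \<otimes>\<^bsub>BijGroup ?X\<^esub> g = compose ?X f g" if "f \<in> Bij ?X" "g \<in> Bij ?X" for f g
    using that by (simp add: BijGroup_def)
  have sB: "s \<in> Bij ?X" if "s \<in> shifts n" for s
    using that shift_in_Bij by (auto simp: shifts_def)
  have commute: "f \<in> ?A \<longleftrightarrow> f \<in> Bij ?X \<and> homeomorphic_map ?T ?T f \<and>
      (\<forall>s \<in> shifts n. f \<otimes>\<^bsub>BijGroup ?X\<^esub> s = s \<otimes>\<^bsub>BijGroup ?X\<^esub> f)" for f
  proof (cases "f \<in> Bij ?X")
    case True
    then show ?thesis
      by (auto simp: shift_automorphisms_def mult sB Bij_def[of ?X])
        (auto simp: mult sB True)
  next
    case False
    then show ?thesis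
      using shift_automorphisms_subset_Bij by auto
  qed
  show ?thesis
  proof (rule B.subgroupI)
    show "?A \<subseteq> carrier (BijGroup ?X)"
      using shift_automorphisms_subset_Bij by (simp add: carrier)
    show "?A \<noteq> {}"
      using shifts_subset_automorphisms by (fastforce simp: shifts_def)
  next
    fix f assume f: "f \<in> ?A"
    then have fB: "f \<in> Bij ?X" and hom: "homeomorphic_map ?T ?T f"
      by (auto simp: commute)
    have inv_eq: "inv\<^bsub>BijGroup ?X\<^esub> f = restrict (inv_into ?X f) ?X"
    proof (rule B.inv_equality)
      show "restrict (inv_into ?X f) ?X \<otimes>\<^bsub>BijGroup ?X\<^esub> f = \<one>\<^bsub>BijGroup ?X\<^esub>"
        using Bij_compose_restrict_eq[OF fB]
        by (simp add: mult fB restrict_inv_into_Bij) (simp add: BijGroup_def)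
    qed (use fB in \<open>simp_all add: carrier restrict_inv_into_Bij\<close>)
    obtain g where g: "homeomorphic_maps ?T ?T f g"
      using hom by (auto simp: homeomorphic_map_maps)
    have "homeomorphic_map ?T ?T g"
      using g by (simp add: homeomorphic_maps_map)
    then have "homeomorphic_map ?T ?T (inv\<^bsub>BijGroup ?X\<^esub> f)"
    proof (rule homeomorphic_map_eq)
      fix x assume "x \<in> topspace ?T"
      then have x: "x \<in> ?X" by (simp add: full_shift_def)
      have "g x \<in> ?X" "f (g x) = x"
        using g x by (auto simp: homeomorphic_maps_def full_shift_def continuous_map_def)
      then show "g x = (inv\<^bsub>BijGroup ?X\<^esub> f) x"
        using fB x by (auto simp: inv_eq Bij_def bij_betw_def intro!: inv_into_f_eq[symmetric])
    qed
    moreover have "inv\<^bsub>BijGroup ?X\<^esub> f \<otimes>\<^bsub>BijGroup ?X\<^esub> s = s \<otimes>\<^bsub>BijGroup ?X\<^esub> inv\<^bsub>BijGroup ?X\<^esub> f"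
      if "s \<in> shifts n" for s
    proof -
      have fc: "f \<in> carrier (BijGroup ?X)" and sc: "s \<in> carrier (BijGroup ?X)"
        using fB sB[OF that] by (simp_all add: carrier)
      have "f \<otimes>\<^bsub>BijGroup ?X\<^esub> s = s \<otimes>\<^bsub>BijGroup ?X\<^esub> f"
        using f that by (simp add: commute)
      then show ?thesis
        using fc sc by (metis B.inv_closed B.inv_solve_left B.inv_solve_right B.m_assoc B.m_closed)
    qed
    ultimately show "inv\<^bsub>BijGroup ?X\<^esub> f \<in> ?A"
      using B.inv_closed[of f] fB by (simp add: commute carrier)
  next
    fix f g assume fg: "f \<in> ?A" "g \<in> ?A"
    then have B: "f \<in> Bij ?X" "g \<in> Bij ?X"
      by (auto simp: commute)
    have "homeomorphic_map ?T ?T (f \<circ> g)"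
      using fg by (auto simp: commute intro: homeomorphic_map_compose)
    then have "homeomorphic_map ?T ?T (f \<otimes>\<^bsub>BijGroup ?X\<^esub> g)"
      by (rule homeomorphic_map_eq) (simp add: mult B compose_def flip: full_shift_def)
    moreover have "f \<otimes>\<^bsub>BijGroup ?X\<^esub> g \<otimes>\<^bsub>BijGroup ?X\<^esub> s = s \<otimes>\<^bsub>BijGroup ?X\<^esub> (f \<otimes>\<^bsub>BijGroup ?X\<^esub> g)"
      if "s \<in> shifts n" for s
    proof -
      have c: "f \<in> carrier (BijGroup ?X)" "g \<in> carrier (BijGroup ?X)" "s \<in> carrier (BijGroup ?X)"
        using B sB[OF that] by (simp_all add: carrier)
      have "f \<otimes>\<^bsub>BijGroup ?X\<^esub> s = s \<otimes>\<^bsub>BijGroup ?X\<^esub> f" "g \<otimes>\<^bsub>BijGroup ?X\<^esub> s = s \<otimes>\<^bsub>BijGroup ?X\<^esub> g"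
        using fg that by (auto simp: commute)
      then show ?thesis
        using c by (metis B.m_assoc)
    qed
    ultimately show "f \<otimes>\<^bsub>BijGroup ?X\<^esub> g \<in> ?A"
      using B.m_closed[of f g] B by (simp add: commute carrier)
  qed
qed

lemma group_shift_aut_group: "group (shift_aut_group n)"
  unfolding shift_aut_group_def
  by (rule subgroup.subgroup_is_group[OF subgroup_shift_automorphisms group_BijGroup])

end

theory Submission
  imports Defs "HOL-Algebra.Generated_Groups"
begin

text \<open>
  Let N be a normal amenable subgroup and suppose that some f in N is not a shift. The proof exhibits
  in N a few explicit automorphisms that play ping-pong, which contradicts amenability.

  If g and h are automorphisms such that the conjugate of g by f commutes with h, then normality puts
  the commutator of g and h into N (lemma \<open>commutator_in_normal\<close>). It therefore suffices to
  find a group of automorphisms that commutes elementwise with its conjugate by f and whose commutators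
  already play ping-pong. Such a group is found by letting automorphisms act only near the occurrences
  of certain large block patterns, chosen so that an occurrence in x and an occurrence in f x are never
  close to each other.

  There are four blocks. They agree except in a small core, where the position of a zero encodes one
  of the symbols 0, 1, 2, 3. Apart from the core and a central pattern Q, a block consists of a cube of
  ones inside a much larger cube of zeros. The large frame of zeros and the corners of the cube of
  ones confine two neighbouring occurrences, one in x and one in f x, to a displacement of at most the
  radius of f if f fixes the zero configuration (\<open>occurrence_displacement\<close>), and exclude them
  altogether otherwise (\<open>no_near_occurrence_if_zero_moved\<close>). The pattern Q rules out the
  finitely many remaining displacements; it exists because f is not a shift
  (\<open>distinguishing_pattern\<close>). Rewriting the cores of blocks in x, and rewriting the
  cores of blocks in f x, are then independent operations (\<open>recolour_commute\<close>).

  Blocks placed one after the other along the diagonal form chains, and a chain carries a word over the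
  four symbols, with 0 as blank. For each letter t in 1, 2, 3 a local involution pushes or pops t at the
  end of such a word. On a right-infinite chain these three involutions act on the reduced words over
  three letters as the free product of three groups of order two acts on itself
  (\<open>holds_stack_toggle\<close>). For distinct letters s, t, u the commutator of sts and sus
  is the reduced word stutus, and it sends every word whose last letter is not s to one whose last
  letter is s. Under an invariant mean each of the three sets of words ending in a given letter thus has
  measure at least one half, although they are disjoint.
\<close>

section \<open>Normal subgroups, commutators and ping-pong\<close>

text \<open>
  With b the conjugate of g by f, the element a = g inv b is a commutator of f and g up to
  order, so it lies in N. Because b commutes with h, the commutator of a and h, which lies in N as well,
  coincides with that of g and h.
\<close>

lemma (in group) commutator_in_normal:
  assumes "N \<lhd> G" "f \<in> N" and g: "g \<in> carrier G" "h \<in> carrier G"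
    and comm: "(f \<otimes> g \<otimes> inv f) \<otimes> h = h \<otimes> (f \<otimes> g \<otimes> inv f)"
  shows "g \<otimes> h \<otimes> inv g \<otimes> inv h \<in> N"
proof -
  interpret N: normal N G by fact
  have f: "f \<in> carrier G" using \<open>f \<in> N\<close> N.subset by blast
  define b where "b = f \<otimes> g \<otimes> inv f"
  have b: "b \<in> carrier G" using f g by (simp add: b_def)
  define a where "a = g \<otimes> inv b"
  have a: "a \<in> carrier G" using g b by (simp add: a_def)
  have "a = (g \<otimes> f \<otimes> inv g) \<otimes> inv f"
    using f g by (simp add: a_def b_def m_assoc inv_mult_group)
  moreover have "g \<otimes> f \<otimes> inv g \<in> N"
    using N.inv_op_closed2 \<open>f \<in> N\<close> g by blast
  ultimately have aN: "a \<in> N" using \<open>f \<in> N\<close> by simp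
  have "h \<otimes> inv a \<otimes> inv h \<in> N"
    using N.inv_op_closed2 aN g by blast
  then have "a \<otimes> (h \<otimes> inv a \<otimes> inv h) \<in> N" using aN by simp
  moreover have "inv b \<otimes> h \<otimes> b = h"
    using comm b g by (metis b_def inv_closed l_inv l_one m_assoc)
  then have "a \<otimes> (h \<otimes> inv a \<otimes> inv h) = g \<otimes> h \<otimes> inv g \<otimes> inv h"
    using b g unfolding a_def by (simp add: inv_mult_group) (metis inv_closed m_assoc m_closed)
  ultimately show ?thesis by simp
qed

lemma (in group) commute_mult:
  assumes "x \<in> carrier G" "y \<in> carrier G" "z \<in> carrier G"
    and "x \<otimes> z = z \<otimes> x" "y \<otimes> z = z \<otimes> y"
  shows "(x \<otimes> y) \<otimes> z = z \<otimes> (x \<otimes> y)"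
  using assms by (metis m_assoc)

lemma (in group) conjugates_commute_mult:
  assumes "f \<in> carrier G" "x \<in> carrier G" "y \<in> carrier G" "z \<in> carrier G"
    and "(f \<otimes> x \<otimes> inv f) \<otimes> z = z \<otimes> (f \<otimes> x \<otimes> inv f)"
    and "(f \<otimes> y \<otimes> inv f) \<otimes> z = z \<otimes> (f \<otimes> y \<otimes> inv f)"
  shows "(f \<otimes> (x \<otimes> y) \<otimes> inv f) \<otimes> z = z \<otimes> (f \<otimes> (x \<otimes> y) \<otimes> inv f)"
proof -
  have "f \<otimes> (x \<otimes> y) \<otimes> inv f = (f \<otimes> x \<otimes> inv f) \<otimes> (f \<otimes> y \<otimes> inv f)"
    using assms(1-4) by (simp add: m_assoc) (simp add: m_assoc[symmetric])
  then show ?thesis using commute_mult[of "f \<otimes> x \<otimes> inv f" "f \<otimes> y \<otimes> inv f" z] assms by simp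
qed

text \<open>
  A choice of representatives for the right cosets of H
  gives a map from the whole group to H that is equivariant under left multiplication by H, and the mean
  of N can be pulled back along it: a set P i of elements of H is measured by the set of elements of N
  that are mapped into P i. This has mean at least one half because k i, an element of both N and H,
  moves the complement of P i into P i.
\<close>

lemma (in group) amenable_no_ping_pong:
  fixes k :: "'i \<Rightarrow> 'a" and P :: "'i \<Rightarrow> 'a set"
  assumes N: "subgroup N G" and am: "amenable (G\<lparr>carrier := N\<rparr>)" and H: "subgroup H G"
    and I: "finite I" "card I \<ge> 3"
    and k: "\<And>i. i \<in> I \<Longrightarrow> k i \<in> N \<inter> H"
    and move: "\<And>i g. i \<in> I \<Longrightarrow> g \<in> H \<Longrightarrow> g \<notin> P i \<Longrightarrow> k i \<otimes> g \<in> P i"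
    and disj: "\<And>i j. i \<in> I \<Longrightarrow> j \<in> I \<Longrightarrow> i \<noteq> j \<Longrightarrow> P i \<inter> P j = {}"
  shows False
proof -
  have l_coset: "g <#\<^bsub>G\<lparr>carrier := N\<rparr>\<^esub> S = g <# S" for g S
    by (simp add: l_coset_def)
  obtain \<mu> :: "'a set \<Rightarrow> real" where \<mu>: "(\<forall>S\<subseteq>N. 0 \<le> \<mu> S) \<and> \<mu> N = 1 \<and>
      (\<forall>S\<subseteq>N. \<forall>T\<subseteq>N. S \<inter> T = {} \<longrightarrow> \<mu> (S \<union> T) = \<mu> S + \<mu> T) \<and>
      (\<forall>g\<in>N. \<forall>S\<subseteq>N. \<mu> (g <# S) = \<mu> S)"
  proof -
    have "carrier (G\<lparr>carrier := N\<rparr>) = N" by simp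
    then show ?thesis
      using conjunct2[OF am[unfolded amenable_def]] that unfolding l_coset by (elim exE) (rule that, simp only:)
  qed
  have nonneg: "0 \<le> \<mu> S" if "S \<subseteq> N" for S using \<mu> that by blast
  have total: "\<mu> N = 1" using \<mu> by blast
  have add: "\<mu> (S \<union> T) = \<mu> S + \<mu> T" if "S \<subseteq> N" "T \<subseteq> N" "S \<inter> T = {}" for S T
    using \<mu> that by blast
  have invar: "\<mu> (g <# S) = \<mu> S" if "g \<in> N" "S \<subseteq> N" for g S using \<mu> that by blast
  have Nsub: "N \<subseteq> carrier G" and Hsub: "H \<subseteq> carrier G"
    using N H by (auto dest: subgroup.subset)
  \<comment> \<open>The map to H divides by the chosen representative of the coset.\<close>
  define rep where "rep h = (SOME z. z \<in> H #> h)" for h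
  define \<phi> where "\<phi> h = h \<otimes> inv (rep h)" for h
  have rep: "rep h \<in> H #> h" if "h \<in> carrier G" for h
    unfolding rep_def by (rule someI[of _ h]) (rule rcos_self[OF that H])
  have \<phi>H: "\<phi> h \<in> H" if h: "h \<in> carrier G" for h
  proof -
    obtain z where z: "z \<in> H" "rep h = z \<otimes> h"
      using rep[OF h] by (auto simp: r_coset_def)
    then have "\<phi> h = inv z"
      using h Hsub by (simp add: \<phi>_def inv_mult_group subset_eq m_assoc[symmetric])
    then show ?thesis using z H by (simp add: subgroup.m_inv_closed)
  qed
  have \<phi>_mult: "\<phi> (g \<otimes> h) = g \<otimes> \<phi> h" if "g \<in> H" "h \<in> carrier G" for g h
  proof -
    have g: "g \<in> carrier G" using that Hsub by blast
    have "H #> (g \<otimes> h) = H #> h"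
      using that g H Hsub by (metis coset_mult_assoc coset_join2)
    moreover have "rep h \<in> carrier G"
      using rep[OF that(2)] Hsub that(2) r_coset_subset_G by blast
    ultimately show ?thesis
      using g that by (simp add: \<phi>_def rep_def m_assoc)
  qed
  define S where "S i = {h \<in> N. \<phi> h \<in> P i}" for i
  have half: "1/2 \<le> \<mu> (S i)" if i: "i \<in> I" for i
  proof -
    have kN: "k i \<in> N" and kH: "k i \<in> H" using k[OF i] by auto
    have sub: "k i <# (N - S i) \<subseteq> S i"
    proof
      fix y assume "y \<in> k i <# (N - S i)"
      then obtain h where h: "h \<in> N" "\<phi> h \<notin> P i" "y = k i \<otimes> h"
        by (auto simp: l_coset_def S_def)
      have "y \<in> N" using h kN N by (simp add: subgroup.m_closed)
      moreover have "\<phi> y \<in> P i"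
        using h \<phi>_mult[OF kH] \<phi>H move[OF i] Nsub by auto
      ultimately show "y \<in> S i" by (simp add: S_def)
    qed
    have SN: "S i \<subseteq> N" by (auto simp: S_def)
    have "\<mu> (S i) = \<mu> (k i <# (N - S i)) + \<mu> (S i - (k i <# (N - S i)))"
      using add[of "k i <# (N - S i)" "S i - (k i <# (N - S i))"] sub SN
      by (metis Diff_disjoint Diff_partition Diff_subset subset_trans)
    then have "\<mu> (N - S i) \<le> \<mu> (S i)"
      using nonneg[of "S i - (k i <# (N - S i))"] invar[OF kN, of "N - S i"] SN by auto
    moreover have "\<mu> (S i) + \<mu> (N - S i) = 1"
      using add[of "S i" "N - S i"] SN total by (simp add: Un_absorb1)
    ultimately show ?thesis by simp
  qed
  have "finite J \<Longrightarrow> J \<subseteq> I \<Longrightarrow> real (card J) / 2 \<le> \<mu> (\<Union>i\<in>J. S i)" for J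
  proof (induction J rule: finite_induct)
    case empty
    show ?case using nonneg[of "{}"] by simp
  next
    case (insert j J)
    have "S j \<inter> (\<Union>i\<in>J. S i) = {}"
      using insert disj by (auto simp: S_def)
    then have "\<mu> (S j \<union> (\<Union>i\<in>J. S i)) = \<mu> (S j) + \<mu> (\<Union>i\<in>J. S i)"
      by (intro add) (auto simp: S_def)
    then show ?case using insert half[of j] by simp
  qed
  then have "real (card I) / 2 \<le> \<mu> (\<Union>i\<in>I. S i)" using I by blast
  moreover have "\<mu> (\<Union>i\<in>I. S i) + \<mu> (N - (\<Union>i\<in>I. S i)) = \<mu> N"
    by (subst add[symmetric]) (auto simp: S_def intro!: arg_cong[of _ _ \<mu>])
  ultimately show False
    using total nonneg[of "N - (\<Union>i\<in>I. S i)"] I by auto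
qed

section \<open>Cubes in the lattice\<close>

definition cube :: "int \<Rightarrow> (int ^ 'd::finite) set" where
  "cube k = {u. \<forall>a. \<bar>u $ a\<bar> \<le> k}"

lemma finite_cube: "finite (cube k :: (int ^ 'd::finite) set)"
proof (rule finite_subset)
  show "(cube k :: (int ^ 'd) set) \<subseteq> vec_lambda ` (PiE UNIV (\<lambda>_. {-k..k}))"
  proof
    fix u :: "int ^ 'd" assume "u \<in> cube k"
    then have "u = vec_lambda (vec_nth u)" "vec_nth u \<in> PiE UNIV (\<lambda>_. {-k..k})"
      by (auto simp: cube_def abs_le_iff minus_le_iff)
    then show "u \<in> vec_lambda ` (PiE UNIV (\<lambda>_. {-k..k}))" by blast
  qed
qed (simp add: finite_PiE)

lemma cube_diff_trans:
  fixes u w z :: "int ^ 'd::finite" and a b c :: int shows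
  "u - w \<in> cube a \<Longrightarrow> w - z \<in> cube b \<Longrightarrow> a + b \<le> c \<Longrightarrow> u - z \<in> cube c"
  unfolding cube_def vector_minus_component mem_Collect_eq
proof
  fix i assume "\<forall>i. \<bar>u $ i - w $ i\<bar> \<le> a" "\<forall>i. \<bar>w $ i - z $ i\<bar> \<le> b" "a + b \<le> c"
  moreover from this have "\<bar>u $ i - w $ i\<bar> \<le> a" "\<bar>w $ i - z $ i\<bar> \<le> b" by blast+
  ultimately show "\<bar>u $ i - z $ i\<bar> \<le> c" by linarith
qed

lemma cube_mono: "u \<in> cube a \<Longrightarrow> a \<le> b \<Longrightarrow> u \<in> cube b"
  by (auto simp: cube_def intro: order_trans)

lemma cube_minus_commute: "u - w \<in> cube a \<longleftrightarrow> w - u \<in> cube a"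
  by (simp add: cube_def abs_minus_commute)

lemma finite_subset_cube:
  fixes D :: "(int ^ 'd::finite) set"
  assumes "finite D"
  shows "\<exists>r\<ge>0. D \<subseteq> cube r"
  using assms
proof (induction D rule: finite_induct)
  case (insert u D)
  then obtain r where r: "r \<ge> 0" "D \<subseteq> cube r" by blast
  have "\<bar>u $ a\<bar> \<le> (\<Sum>a\<in>UNIV. \<bar>u $ a\<bar>)" for a
    by (intro member_le_sum) auto
  then have "u \<in> cube (\<Sum>a\<in>UNIV. \<bar>u $ a\<bar>)" by (simp add: cube_def)
  moreover have s: "0 \<le> (\<Sum>a\<in>UNIV. \<bar>u $ a\<bar>)" by (simp add: sum_nonneg)
  ultimately have "insert u D \<subseteq> cube (r + (\<Sum>a\<in>UNIV. \<bar>u $ a\<bar>))"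
    using r by (auto elim!: cube_mono)
  then show ?case using r s by (metis add_nonneg_nonneg)
qed auto

section \<open>Continuous maps of the full shift are local\<close>

definition local_map :: "nat \<Rightarrow> int \<Rightarrow> ((int ^ 'd::finite \<Rightarrow> nat) \<Rightarrow> int ^ 'd \<Rightarrow> nat) \<Rightarrow> bool" where
  "local_map n r F \<longleftrightarrow> (\<forall>x\<in>full_shift n. \<forall>y\<in>full_shift n. \<forall>u.
     (\<forall>w. w - u \<in> cube r \<longrightarrow> x w = y w) \<longrightarrow> F x u = F y u)"

lemma local_mapD:
  "local_map n r F \<Longrightarrow> x \<in> full_shift n \<Longrightarrow> y \<in> full_shift n \<Longrightarrow>
    (\<And>w. w - u \<in> cube r \<Longrightarrow> x w = y w) \<Longrightarrow> F x u = F y u"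
  unfolding local_map_def by blast

lemma local_map_mono: "local_map n r F \<Longrightarrow> r \<le> r' \<Longrightarrow> local_map n r' F"
  unfolding local_map_def using cube_mono by blast

text \<open>
  Such a set is a union of cylinders that fix the coordinates in D.
\<close>

lemma openin_finitely_determined:
  fixes D :: "(int ^ 'd::finite) set"
  assumes D: "finite D" and S: "S \<subseteq> full_shift n"
    and det: "\<And>x y. x \<in> S \<Longrightarrow> y \<in> full_shift n \<Longrightarrow> (\<And>u. u \<in> D \<Longrightarrow> y u = x u) \<Longrightarrow> y \<in> S"
  shows "openin (full_shift_topology n) S"
  unfolding full_shift_topology_def openin_product_topology_alt
proof
  fix x assume x: "x \<in> S"
  then have xn: "x u < n" for u using S by (auto simp: full_shift_iff)
  let ?U = "\<lambda>u. if u \<in> D then {x u} else {..<n}"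
  have "finite {i \<in> UNIV. ?U i \<noteq> topspace (discrete_topology {..<n})}"
    by (rule finite_subset[OF _ D]) auto
  moreover have "Pi\<^sub>E UNIV ?U \<subseteq> S"
  proof
    fix y assume y: "y \<in> Pi\<^sub>E UNIV ?U"
    have "y u < n" for u using y xn by (auto simp: PiE_iff split: if_splits dest!: spec[of _ u])
    moreover have "y u = x u" if "u \<in> D" for u
      using y that by (auto simp: PiE_iff split: if_splits dest!: spec[of _ u])
    ultimately show "y \<in> S" using det[OF x, of y] by (simp add: full_shift_iff)
  qed
  ultimately show "\<exists>U. finite {i \<in> UNIV. U i \<noteq> topspace (discrete_topology {..<n})} \<and>
      (\<forall>i\<in>UNIV. openin (discrete_topology {..<n}) (U i)) \<and> x \<in> Pi\<^sub>E UNIV U \<and> Pi\<^sub>E UNIV U \<subseteq> S"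
    using xn by (intro exI[of _ ?U]) auto
qed

lemma local_map_continuous:
  fixes F :: "(int ^ 'd::finite \<Rightarrow> nat) \<Rightarrow> int ^ 'd \<Rightarrow> nat"
  assumes F: "local_map n r F" and maps: "\<And>x. x \<in> full_shift n \<Longrightarrow> F x \<in> full_shift n"
  shows "continuous_map (full_shift_topology n) (full_shift_topology n) F"
proof -
  have "continuous_map (full_shift_topology n) (discrete_topology {..<n}) (\<lambda>x. F x u)" for u
    unfolding continuous_map_def
  proof (intro conjI allI impI)
    show "(\<lambda>x. F x u) \<in> topspace (full_shift_topology n) \<rightarrow> topspace (discrete_topology {..<n})"
      using maps by (auto simp: full_shift_def[symmetric] full_shift_iff)
    fix U
    have "finite ((\<lambda>w. w + u) ` cube r)" by (simp add: finite_cube)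
    then show "openin (full_shift_topology n) {x \<in> topspace (full_shift_topology n). F x u \<in> U}"
    proof (rule openin_finitely_determined)
      fix x y assume x: "x \<in> {x \<in> topspace (full_shift_topology n). F x u \<in> U}" and y: "y \<in> full_shift n"
        and eq: "\<And>w. w \<in> (\<lambda>w. w + u) ` cube r \<Longrightarrow> y w = x w"
      have "F y u = F x u"
      proof (rule local_mapD[OF F y])
        fix w assume "w - u \<in> cube r"
        then have "w \<in> (\<lambda>w. w + u) ` cube r" by (intro image_eqI[of _ _ "w - u"]) auto
        then show "y w = x w" by (rule eq)
      qed (use x in \<open>simp add: full_shift_def\<close>)
      then show "y \<in> {x \<in> topspace (full_shift_topology n). F x u \<in> U}"
        using x y by (simp add: full_shift_def)
    qed (auto simp: full_shift_def)
  qed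
  then show ?thesis
    unfolding full_shift_topology_def[of n] continuous_map_componentwise_UNIV by auto
qed

text \<open>
  Every point has a cylinder on which the value of f at the origin is constant. By compactness
  finitely many of these cylinders cover the full shift, and the coordinates that they involve determine
  the value.
\<close>

lemma continuous_finitely_determined:
  fixes f :: "(int ^ 'd::finite \<Rightarrow> nat) \<Rightarrow> int ^ 'd \<Rightarrow> nat"
  assumes cont: "continuous_map (full_shift_topology n) (full_shift_topology n) f"
  shows "\<exists>D. finite D \<and> (\<forall>x\<in>full_shift n. \<forall>y\<in>full_shift n. (\<forall>u\<in>D. x u = y u) \<longrightarrow> f x 0 = f y 0)"
proof -
  let ?T = "full_shift_topology n :: (int ^ 'd \<Rightarrow> nat) topology"
  have comp: "compact_space ?T"
    unfolding full_shift_topology_def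
    by (simp add: compact_space_product_topology compact_space_discrete_topology)
  have fc: "continuous_map ?T (discrete_topology {..<n}) (\<lambda>x. f x 0)"
    using cont unfolding full_shift_topology_def[of n] continuous_map_componentwise_UNIV by auto
  have ex: "\<exists>D. finite D \<and> (\<forall>y\<in>full_shift n. (\<forall>u\<in>D. y u = x u) \<longrightarrow> f y 0 = f x 0)"
    if x: "x \<in> full_shift n" for x
  proof -
    have "f x 0 < n"
      using fc x by (auto simp: continuous_map_def full_shift_def)
    then have "openin ?T {y \<in> topspace ?T. f y 0 \<in> {f x 0}}"
      by (intro openin_continuous_map_preimage[OF fc]) auto
    then obtain U where U: "finite {i \<in> UNIV. U i \<noteq> topspace (discrete_topology {..<n})}"
      "x \<in> Pi\<^sub>E UNIV U" "Pi\<^sub>E UNIV U \<subseteq> {y \<in> topspace ?T. f y 0 \<in> {f x 0}}"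
      using x unfolding full_shift_topology_def openin_product_topology_alt
      by (drule_tac bspec[of _ _ x]) (auto simp: full_shift_def full_shift_topology_def)
    have "f y 0 = f x 0" if y: "y \<in> full_shift n" and eq: "\<forall>u\<in>{i. U i \<noteq> {..<n}}. y u = x u" for y
    proof -
      have "y \<in> Pi\<^sub>E UNIV U"
        using U(2) y eq by (auto simp: PiE_iff full_shift_iff) (metis lessThan_iff)
      then show ?thesis using U(3) by blast
    qed
    then show ?thesis using U(1) by (intro exI[of _ "{i. U i \<noteq> {..<n}}"]) auto
  qed
  then obtain D where D: "\<And>x. x \<in> full_shift n \<Longrightarrow> finite (D x)"
    "\<And>x y. x \<in> full_shift n \<Longrightarrow> y \<in> full_shift n \<Longrightarrow> (\<forall>u\<in>D x. y u = x u) \<Longrightarrow> f y 0 = f x 0"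
    by metis
  define O' where "O' x = {y \<in> full_shift n. \<forall>u\<in>D x. y u = x u}" for x
  have "\<exists>\<F>. finite \<F> \<and> \<F> \<subseteq> O' ` full_shift n \<and> topspace ?T \<subseteq> \<Union>\<F>"
  proof (rule compactinD[OF comp[unfolded compact_space_def]])
    show "openin ?T U" if "U \<in> O' ` full_shift n" for U
      using that by (auto simp: O'_def intro!: openin_finitely_determined[OF D(1)])
    show "topspace ?T \<subseteq> \<Union> (O' ` full_shift n)"
      by (auto simp: O'_def full_shift_def[symmetric])
  qed
  then obtain K where K: "finite K" "K \<subseteq> full_shift n" "full_shift n \<subseteq> (\<Union>x\<in>K. O' x)"
    by (metis (no_types, lifting) finite_subset_image full_shift_def)
  show ?thesis
  proof (intro exI[of _ "\<Union>x\<in>K. D x"] conjI ballI impI)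
    show "finite (\<Union>x\<in>K. D x)" using K D(1) by blast
    fix x y assume x: "x \<in> full_shift n" and y: "y \<in> full_shift n" and eq: "\<forall>u\<in>\<Union> (D ` K). x u = y u"
    obtain z where z: "z \<in> K" "x \<in> O' z" using K(3) x by blast
    have "f x 0 = f z 0" "f y 0 = f z 0"
      using z eq x y K(2) by (auto simp: O'_def intro!: D(2))
    then show "f x 0 = f y 0" by simp
  qed
qed

lemma automorphism_shift:
  assumes f: "f \<in> shift_automorphisms n" and x: "x \<in> full_shift n"
  shows "f (\<lambda>w. x (w + v)) u = f x (u + v)"
proof -
  have "compose (full_shift n) f (shift n v) = compose (full_shift n) (shift n v) f"
    using f by (auto simp: shift_automorphisms_def shifts_def)
  then have "f (shift n v x) = shift n v (f x)"
    using x by (metis compose_eq)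
  moreover have "f x \<in> full_shift n"
    using f x by (auto simp: shift_automorphisms_def full_shift_def dest: homeomorphic_imp_surjective_map)
  ultimately show ?thesis using x by (simp add: shift_def)
qed

text \<open>
  This is the Curtis-Hedlund-Lyndon theorem: commutation with the shifts carries the finite window at the origin to every other site.
\<close>

lemma automorphism_local_map:
  fixes f :: "(int ^ 'd::finite \<Rightarrow> nat) \<Rightarrow> int ^ 'd \<Rightarrow> nat"
  assumes f: "f \<in> shift_automorphisms n"
  shows "\<exists>r\<ge>0. local_map n r f"
proof -
  have "continuous_map (full_shift_topology n) (full_shift_topology n) f"
    using f by (auto simp: shift_automorphisms_def dest: homeomorphic_imp_continuous_map)
  then obtain D where D: "finite D"
    "\<And>x y. x \<in> full_shift n \<Longrightarrow> y \<in> full_shift n \<Longrightarrow> (\<forall>u\<in>D. x u = y u) \<Longrightarrow> f x 0 = f y 0"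
    using continuous_finitely_determined by metis
  obtain r where r: "r \<ge> 0" "D \<subseteq> cube r" using finite_subset_cube[OF D(1)] by blast
  have "f x u = f y u" if xy: "x \<in> full_shift n" "y \<in> full_shift n"
    and eq: "\<forall>w. w - u \<in> cube r \<longrightarrow> x w = y w" for x y u
  proof -
    have "f (\<lambda>w. x (w + u)) 0 = f (\<lambda>w. y (w + u)) 0"
    proof (rule D(2))
      show "\<forall>w\<in>D. x (w + u) = y (w + u)" using eq r by auto
    qed (use xy in \<open>simp_all add: full_shift_iff\<close>)
    then show ?thesis using automorphism_shift[OF f xy(1), of u 0] automorphism_shift[OF f xy(2), of u 0] by simp
  qed
  then show ?thesis using r unfolding local_map_def by blast
qed

section \<open>Blocks with a rewritable core\<close>

text \<open>
  The pattern Q is used on the cube of radius m, and r bounds the radius of the automorphisms that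
  blocks have to resist.
\<close>

locale block_code =
  fixes n :: nat and m r :: int and Q :: "int ^ 'd::finite \<Rightarrow> nat"
  assumes n: "n \<ge> 2" and m: "m \<ge> 0" and r: "r \<ge> 0" and Q: "\<And>u. Q u < n"
begin

text \<open>
  The nested radii of a block: cores differ only within q, ones fill the cube of radius k, and zeros
  surround it up to radius l. The distances are what the later arguments need: k exceeds q + 2 r so that
  the corners of the cube of ones stay visible in any block that reaches a core up to distance r, and l
  leaves room for a copy of that cube displaced by 2 k + r, enlarged by r.
\<close>

definition q :: int where "q = m + 4"
definition k :: int where "k = q + 2 * r + 1"
definition l :: int where "l = 3 * k + 3 * r + 3"

definition block :: "nat \<Rightarrow> int ^ 'd \<Rightarrow> nat" where
  "block s u = (if u \<in> cube m then Q u else if u = vec (m + 1 + int s) then 0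
     else if u \<in> cube k then 1 else 0)"

definition occurs :: "(int ^ 'd \<Rightarrow> nat) \<Rightarrow> int ^ 'd \<Rightarrow> nat \<Rightarrow> bool" where
  "occurs x i s \<longleftrightarrow> s < 4 \<and> (\<forall>u. u - i \<in> cube l \<longrightarrow> x u = block s (u - i))"

lemma sizes: "0 \<le> m" "0 \<le> r" "q = m + 4" "k = m + 2 * r + 5" "l = 3 * m + 9 * r + 18"
  using m r by (simp_all add: q_def k_def l_def)

lemma block_less: "block s u < n"
  using n Q by (auto simp: block_def)

lemma block_outside: "u \<notin> cube k \<Longrightarrow> block s u = 0"
  using sizes cube_mono[of u m k] by (auto simp: block_def)

lemma vec_in_cube: "(vec c :: int ^ 'd) \<in> cube b \<longleftrightarrow> \<bar>c\<bar> \<le> b"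
  by (simp add: cube_def)

lemma block_off_core:
  "u \<notin> cube q \<Longrightarrow> s < 4 \<Longrightarrow> s' < 4 \<Longrightarrow> block s u = block s' u"
  using sizes by (auto simp: block_def vec_in_cube)

text \<open>
  Every corner of the cube of ones lies outside the core, whatever the symbol and the pattern Q; these
  nonzero sites are the landmarks by which occurrences are compared.
\<close>

lemma block_corner:
  fixes c :: "int ^ 'd"
  assumes c: "\<And>a. \<bar>c $ a\<bar> = k" and s: "s < 4"
  shows "block s c = 1"
proof -
  have "c \<notin> cube m" "c \<in> cube k" using c sizes by (auto simp: cube_def)
  moreover have "c \<noteq> vec (m + 1 + int s)" using c[of undefined] sizes s by auto
  ultimately show ?thesis by (simp add: block_def)
qed

lemma block_inj:
  assumes "s < 4" "block s (vec (m + 1 + int s)) = block s' (vec (m + 1 + int s))"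
  shows "s = s'"
proof (rule ccontr)
  assume "s \<noteq> s'"
  then have "(vec (m + 1 + int s) :: int ^ 'd) \<noteq> vec (m + 1 + int s')"
    by (auto simp: vec_eq_iff)
  then show False
    using assms sizes by (simp add: block_def vec_in_cube)
qed

lemma occurs_unique:
  assumes "occurs x i s" "occurs x i s'"
  shows "s = s'"
proof (rule block_inj)
  show "s < 4" using assms by (simp add: occurs_def)
  then have "(vec (m + 1 + int s) :: int ^ 'd) \<in> cube l" using sizes by (simp add: vec_in_cube)
  then show "block s (vec (m + 1 + int s)) = block s' (vec (m + 1 + int s))"
    using assms unfolding occurs_def by (metis add_diff_cancel_left')
qed

lemma occurs_outside: "occurs x i s \<Longrightarrow> u - i \<in> cube l \<Longrightarrow> u - i \<notin> cube k \<Longrightarrow> x u = 0"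
  by (simp add: occurs_def block_outside)

lemma zero_in_full_shift: "(\<lambda>_. 0) \<in> full_shift n"
  using n by (simp add: full_shift_iff)

text \<open>
  The maps F and G are local of radius p and fix the zero configuration, and G undoes F at x. Choose
  the corner c of the cube of ones that points from i towards j. If the displacement is larger than
  2 k + p in some coordinate, the p-neighbourhood of the corner at i + c falls into the zero frame of the block of F x at j, so applying G would
  make x vanish there. If the displacement is moderate but exceeds p in some coordinate, the corner
  j + c of the block of F x lies, together with its p-neighbourhood, in the zero frame of the block of x
  at i, so F x would vanish there.
\<close>

lemma occurrence_displacement:
  assumes F: "local_map n p F" and G: "local_map n p G" and p: "0 \<le> p" "p \<le> r"
    and x: "x \<in> full_shift n" "F x \<in> full_shift n" "G (F x) = x"
    and zero: "\<And>u. F (\<lambda>_. 0) u = 0" "\<And>u. G (\<lambda>_. 0) u = 0"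
    and occ: "occurs x i s" "occurs (F x) j s'" and near: "j - i \<in> cube (l + q + r)"
  shows "j - i \<in> cube p"
proof -
  define c where "c = (\<chi> a. if j $ a \<ge> i $ a then k else - k)"
  have c: "\<And>a. \<bar>c $ a\<bar> = k" using sizes by (simp add: c_def)
  have ss: "s < 4" "s' < 4" using occ by (auto simp: occurs_def)
  have cl: "c \<in> cube l" using c sizes by (simp add: cube_def)
  have v: "\<bar>j $ a - i $ a\<bar> \<le> l + q + r" for a using near by (simp add: cube_def)
  \<comment> \<open>The corner of the block of x lies in the zero frame of the block of F x.\<close>
  have small: "\<bar>j $ a - i $ a\<bar> \<le> 2 * k + p" for a
  proof (rule ccontr)
    assume a: "\<not> \<bar>j $ a - i $ a\<bar> \<le> 2 * k + p"
    have "G (F x) (i + c) = G (\<lambda>_. 0) (i + c)"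
    proof (rule local_mapD[OF G x(2) zero_in_full_shift])
      fix w assume w: "w - (i + c) \<in> cube p"
      have "\<bar>w $ b - j $ b\<bar> \<le> l" for b
      proof -
        have "\<bar>w $ b - (i $ b + c $ b)\<bar> \<le> p" using w by (simp add: cube_def)
        then show ?thesis using v[of b] sizes p by (auto simp: c_def split: if_splits)
      qed
      moreover have "\<not> \<bar>w $ a - j $ a\<bar> \<le> k"
      proof -
        have "\<bar>w $ a - (i $ a + c $ a)\<bar> \<le> p" using w by (simp add: cube_def)
        then show ?thesis using a sizes p by (auto simp: c_def split: if_splits)
      qed
      ultimately show "F x w = 0"
        by (intro occurs_outside[OF occ(2)]) (auto simp: cube_def)
    qed
    moreover have "x (i + c) = 1"
      using occ(1) cl block_corner[OF c ss(1)] unfolding occurs_def by (metis add_diff_cancel_left')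
    ultimately show False using zero x by simp
  qed
  show ?thesis
  proof (rule ccontr)
    assume "j - i \<notin> cube p"
    then obtain a where a: "\<not> \<bar>j $ a - i $ a\<bar> \<le> p" by (auto simp: cube_def)
    \<comment> \<open>Now the corner of the block of F x lies in the zero frame of the block of x.\<close>
    have "F x (j + c) = F (\<lambda>_. 0) (j + c)"
    proof (rule local_mapD[OF F x(1) zero_in_full_shift])
      fix w assume w: "w - (j + c) \<in> cube p"
      have "\<bar>w $ b - i $ b\<bar> \<le> l" for b
      proof -
        have "\<bar>w $ b - (j $ b + c $ b)\<bar> \<le> p" using w by (simp add: cube_def)
        then show ?thesis using small[of b] sizes p by (auto simp: c_def split: if_splits)
      qed
      moreover have "\<not> \<bar>w $ a - i $ a\<bar> \<le> k"
      proof -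
        have "\<bar>w $ a - (j $ a + c $ a)\<bar> \<le> p" using w by (simp add: cube_def)
        then show ?thesis using a sizes p by (auto simp: c_def split: if_splits)
      qed
      ultimately show "x w = 0"
        by (intro occurs_outside[OF occ(1)]) (auto simp: cube_def)
    qed
    moreover have "F x (j + c) = 1"
      using occ(2) cl block_corner[OF c ss(2)] unfolding occurs_def by (metis add_diff_cancel_left')
    ultimately show False using zero by simp
  qed
qed

text \<open>
  Inside the zero frame of a block of x, at distance more than r from its boundary, F x coincides with the
  image of the zero configuration and is nowhere zero, whereas it vanishes on the zero frame of each of its
  own blocks. The site i + c of the proof lies in both regions.
\<close>

lemma no_near_occurrence_if_zero_moved:
  assumes F: "local_map n r F" and x: "x \<in> full_shift n"
    and zero: "\<And>u. F (\<lambda>_. 0) u \<noteq> 0"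
    and occ: "occurs x i s" "occurs (F x) j s'"
  shows "j - i \<notin> cube (l + q + r)"
proof
  assume near: "j - i \<in> cube (l + q + r)"
  have v: "\<bar>j $ a - i $ a\<bar> \<le> l + q + r" for a using near by (simp add: cube_def)
  \<comment> \<open>An arbitrary coordinate, in which the site will leave both cubes of ones.\<close>
  obtain a :: 'd where True by blast
  \<comment> \<open>Two candidates for the distance of the site from i; they differ by more than 2 k, so at least one of them avoids the cube of ones around j.\<close>
  define h where "h = (if \<bar>k + r + 1 - \<bar>j $ a - i $ a\<bar>\<bar> > k then k + r + 1 else 3 * k + r + 2)"
  have h: "h \<ge> k + r + 1" "h \<le> 3 * k + r + 2" "\<bar>h - \<bar>j $ a - i $ a\<bar>\<bar> > k"
    using sizes by (auto simp: h_def)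
  define c where "c = (\<chi> a. if j $ a \<ge> i $ a then h else - h)"
  have "F x (i + c) = F (\<lambda>_. 0) (i + c)"
  proof (rule local_mapD[OF F x zero_in_full_shift])
    fix w assume w: "w - (i + c) \<in> cube r"
    have "\<bar>w $ b - i $ b\<bar> \<le> l \<and> \<not> \<bar>w $ b - i $ b\<bar> \<le> k" for b
    proof -
      have "\<bar>w $ b - (i $ b + c $ b)\<bar> \<le> r" using w by (simp add: cube_def)
      then show ?thesis using h sizes by (auto simp: c_def split: if_splits)
    qed
    then show "x w = 0"
      by (intro occurs_outside[OF occ(1)]) (auto simp: cube_def)
  qed
  moreover have "F x (i + c) = 0"
  proof (rule occurs_outside[OF occ(2)])
    have "\<bar>(i + c - j) $ b\<bar> \<le> l" for b
      using v[of b] h sizes by (auto simp: c_def)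
    then show "i + c - j \<in> cube l" by (simp add: cube_def)
    have "\<bar>(i + c - j) $ a\<bar> > k" using h(3) by (auto simp: c_def split: if_splits)
    then show "i + c - j \<notin> cube k" by (auto simp: cube_def not_le)
  qed
  ultimately show False using zero by simp
qed

text \<open>
  The identity is an automorphism of radius 0, so overlapping blocks of the same configuration
  coincide.
\<close>

lemma occurs_apart:
  assumes "x \<in> full_shift n" "occurs x i s" "occurs x j s'" "j - i \<in> cube (l + q + r)"
  shows "j = i"
proof -
  have "local_map n 0 (\<lambda>x. x)" by (auto simp: local_map_def cube_def)
  then have "j - i \<in> cube 0"
    using occurrence_displacement[of 0 "\<lambda>x. x" "\<lambda>x. x" x i s j s'] assms r by simp
  then show ?thesis by (simp add: cube_def vec_eq_iff)
qed

definition symbols :: "(int ^ 'd \<Rightarrow> nat) \<Rightarrow> int ^ 'd \<Rightarrow> nat option" where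
  "symbols x i = (if \<exists>s. occurs x i s then Some (THE s. occurs x i s) else None)"

lemma symbols_eq_Some: "symbols x i = Some s \<longleftrightarrow> occurs x i s"
proof
  assume "symbols x i = Some s"
  then obtain s' where s': "occurs x i s'" "s = (THE s. occurs x i s)"
    by (auto simp: symbols_def split: if_splits)
  then show "occurs x i s" using occurs_unique by (metis theI)
next
  assume "occurs x i s"
  then show "symbols x i = Some s"
    using occurs_unique by (auto simp: symbols_def intro!: the_equality)
qed

lemma symbols_eq_None: "symbols x i = None \<longleftrightarrow> (\<forall>s. \<not> occurs x i s)"
  by (simp add: symbols_def)

lemma symbols_cong:
  assumes "\<And>u. u - i \<in> cube l \<Longrightarrow> x u = y u"
  shows "symbols x i = symbols y i"
proof -
  have "occurs x i = occurs y i" unfolding occurs_def using assms by (intro ext) metis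
  then show ?thesis unfolding symbols_def by simp
qed

text \<open>
  Rewrites the cores of the blocks according to a field of symbols. The choice of i is unambiguous
  whenever \<open>\<sigma>\<close> is defined exactly at the blocks of x, since cores are far
  apart.
\<close>

definition recolour :: "(int ^ 'd \<Rightarrow> nat) \<Rightarrow> (int ^ 'd \<Rightarrow> nat option) \<Rightarrow> int ^ 'd \<Rightarrow> nat" where
  "recolour x \<sigma> u =
     (if \<exists>i. \<sigma> i \<noteq> None \<and> u - i \<in> cube q
      then let i = (SOME i. \<sigma> i \<noteq> None \<and> u - i \<in> cube q) in block (the (\<sigma> i)) (u - i)
      else x u)"

definition compatible :: "(int ^ 'd \<Rightarrow> nat) \<Rightarrow> (int ^ 'd \<Rightarrow> nat option) \<Rightarrow> bool" where
  "compatible x \<sigma> \<longleftrightarrow> dom \<sigma> = dom (symbols x) \<and> ran \<sigma> \<subseteq> {..<4}"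

lemma compatible_occurs: "compatible x \<sigma> \<Longrightarrow> \<sigma> i = Some s \<Longrightarrow> \<exists>s'. occurs x i s'"
  unfolding compatible_def using symbols_eq_Some[of x i] by blast

lemma compatible_symbols: "compatible x (symbols x)"
  unfolding compatible_def ran_def by (auto simp: symbols_eq_Some occurs_def)

lemma recolour_in_full_shift: "x \<in> full_shift n \<Longrightarrow> recolour x \<sigma> \<in> full_shift n"
  by (simp add: full_shift_iff recolour_def Let_def block_less)

lemma recolour_away: "(\<And>i. \<sigma> i \<noteq> None \<Longrightarrow> u - i \<notin> cube q) \<Longrightarrow> recolour x \<sigma> u = x u"
  unfolding recolour_def by (subst if_not_P) blast+

lemma recolour_near:
  assumes x: "x \<in> full_shift n" and \<sigma>: "compatible x \<sigma>" "\<sigma> i = Some s" and u: "u - i \<in> cube q"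
  shows "recolour x \<sigma> u = block s (u - i)"
proof -
  have "i' = i" if "\<sigma> i' \<noteq> None" "u - i' \<in> cube q" for i'
  proof -
    have "i' - i \<in> cube (l + q + r)"
      using cube_diff_trans[of i' u q i q "l + q + r"] that u sizes by (simp add: cube_minus_commute)
    then show ?thesis
      using occurs_apart[OF x] compatible_occurs[OF \<sigma>(1)] \<sigma>(2) that by blast
  qed
  then have "(SOME i. \<sigma> i \<noteq> None \<and> u - i \<in> cube q) = i"
    using \<sigma> u by (intro some_equality) auto
  moreover have "\<exists>i. \<sigma> i \<noteq> None \<and> u - i \<in> cube q" using \<sigma> u by auto
  ultimately show ?thesis using \<sigma> by (simp only: recolour_def if_True Let_def option.sel)
qed

lemma recolour_cong:
  assumes "\<And>i. u - i \<in> cube q \<Longrightarrow> \<sigma> i = \<sigma>' i" and "x u = y u"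
  shows "recolour x \<sigma> u = recolour y \<sigma>' u"
proof -
  have eq: "(\<lambda>i. \<sigma> i \<noteq> None \<and> u - i \<in> cube q) = (\<lambda>i. \<sigma>' i \<noteq> None \<and> u - i \<in> cube q)"
    using assms by auto
  show ?thesis
  proof (cases "\<exists>i. \<sigma> i \<noteq> None \<and> u - i \<in> cube q")
    case True
    then have "\<sigma> (SOME i. \<sigma> i \<noteq> None \<and> u - i \<in> cube q) = \<sigma>' (SOME i. \<sigma> i \<noteq> None \<and> u - i \<in> cube q)"
      using someI_ex[OF True] assms(1) by blast
    moreover have "\<exists>i. \<sigma>' i \<noteq> None \<and> u - i \<in> cube q"
      using True eq by metis
    ultimately show ?thesis
      using True by (simp only: recolour_def if_True Let_def eq)
  next
    case False
    then show ?thesis using eq assms(2) unfolding recolour_def by metis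
  qed
qed

lemma recolour_occurs:
  assumes x: "x \<in> full_shift n" and \<sigma>: "compatible x \<sigma>" and i: "\<sigma> i = Some s"
  shows "occurs (recolour x \<sigma>) i s"
proof -
  have s: "s < 4" using \<sigma> i by (auto simp: compatible_def ran_def)
  obtain s' where s': "occurs x i s'" using compatible_occurs[OF \<sigma> i] by blast
  have "recolour x \<sigma> u = block s (u - i)" if u: "u - i \<in> cube l" for u
  proof (cases "u - i \<in> cube q")
    case True
    then show ?thesis using recolour_near[OF x \<sigma> i] by blast
  next
    case False
    have "recolour x \<sigma> u = x u"
    proof (rule recolour_away, rule notI)
      fix j assume j: "\<sigma> j \<noteq> None" "u - j \<in> cube q"
      then have "j - i \<in> cube (l + q + r)"
        using cube_diff_trans[of j u q i l "l + q + r"] u sizes by (simp add: cube_minus_commute)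
      then have "j = i" using occurs_apart[OF x s'] compatible_occurs[OF \<sigma>] j(1) by blast
      then show False using j False by simp
    qed
    also have "x u = block s' (u - i)" using s' u by (simp add: occurs_def)
    also have "\<dots> = block s (u - i)" using False s s' by (intro block_off_core) (auto simp: occurs_def)
    finally show ?thesis .
  qed
  then show ?thesis using s by (simp add: occurs_def)
qed

text \<open>
  Rewriting cores neither destroys nor creates blocks. A block that appeared only after the rewriting
  would have to meet a rewritten core, and two overlapping blocks of one configuration coincide.
\<close>

lemma symbols_recolour:
  assumes x: "x \<in> full_shift n" and \<sigma>: "compatible x \<sigma>"
  shows "symbols (recolour x \<sigma>) = \<sigma>"
proof
  fix i
  show "symbols (recolour x \<sigma>) i = \<sigma> i"
  proof (cases "\<sigma> i")
    case (Some s)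
    then show ?thesis using recolour_occurs[OF x \<sigma>] by (simp add: symbols_eq_Some)
  next
    case None
    have "\<not> occurs (recolour x \<sigma>) i s" for s
    proof
      assume occ: "occurs (recolour x \<sigma>) i s"
      have "symbols x i = symbols (recolour x \<sigma>) i"
      proof (rule symbols_cong[symmetric], rule recolour_away, rule notI)
        fix u j assume u: "u - i \<in> cube l" and j: "\<sigma> j \<noteq> None" "u - j \<in> cube q"
        then have "j - i \<in> cube (l + q + r)"
          using cube_diff_trans[of j u q i l "l + q + r"] sizes by (simp add: cube_minus_commute)
        moreover obtain s' where "occurs (recolour x \<sigma>) j s'"
          using recolour_occurs[OF x \<sigma>] j by blast
        ultimately have "j = i"
          using occurs_apart[OF recolour_in_full_shift[OF x] occ] by blast
        then show False using j None by simp
      qed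
      then have "symbols x i = Some s" using occ by (simp only: symbols_eq_Some)
      then have "i \<in> dom \<sigma>" using \<sigma> by (simp add: compatible_def domI)
      then show False using None by (simp add: domIff)
    qed
    then have "symbols (recolour x \<sigma>) i = None" by (simp only: symbols_eq_None not_False_eq_True simp_thms)
    then show ?thesis using None by (simp only:)
  qed
qed

lemma recolour_recolour:
  assumes "dom \<sigma> = dom \<tau>"
  shows "recolour (recolour x \<sigma>) \<tau> = recolour x \<tau>"
proof
  fix u
  show "recolour (recolour x \<sigma>) \<tau> u = recolour x \<tau> u"
  proof (cases "\<exists>i. \<tau> i \<noteq> None \<and> u - i \<in> cube q")
    case True
    then show ?thesis by (simp only: recolour_def if_True)
  next
    case False
    then have "\<not> (\<exists>i. \<sigma> i \<noteq> None \<and> u - i \<in> cube q)" using assms by (metis domIff)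
    then show ?thesis using False by (simp only: recolour_def if_False)
  qed
qed

lemma recolour_symbols:
  assumes x: "x \<in> full_shift n"
  shows "recolour x (symbols x) = x"
proof
  fix u
  show "recolour x (symbols x) u = x u"
  proof (cases "\<exists>i. symbols x i \<noteq> None \<and> u - i \<in> cube q")
    case True
    then obtain i s where i: "symbols x i = Some s" "u - i \<in> cube q" by blast
    then have "u - i \<in> cube l" using sizes cube_mono[of "u - i" q l] by simp
    then show ?thesis
      using recolour_near[OF x compatible_symbols i] i by (simp add: symbols_eq_Some occurs_def)
  next
    case False
    then show ?thesis by (intro recolour_away) blast
  qed
qed

end

section \<open>Rewriting blocks on both sides of an automorphism\<close>

text \<open>
  The automorphism f with inverse f' keeps the blocks of x away from those of f x. The condition is
  symmetric in f and f', so that everything below also applies to the inverse.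
\<close>

locale separated_codes = block_code n m r Q
  for n m r and Q :: "int ^ 'd::finite \<Rightarrow> nat" +
  fixes f f' :: "(int ^ 'd::finite \<Rightarrow> nat) \<Rightarrow> int ^ 'd \<Rightarrow> nat"
  assumes f_local: "local_map n r f" and f'_local: "local_map n r f'"
    and f_in: "x \<in> full_shift n \<Longrightarrow> f x \<in> full_shift n"
    and f'_in: "x \<in> full_shift n \<Longrightarrow> f' x \<in> full_shift n"
    and f'_f: "x \<in> full_shift n \<Longrightarrow> f' (f x) = x"
    and f_f': "x \<in> full_shift n \<Longrightarrow> f (f' x) = x"
    and apart: "x \<in> full_shift n \<Longrightarrow> occurs x i s \<Longrightarrow> occurs (f x) j s' \<Longrightarrow>
      j - i \<notin> cube (l + q + r)"
begin

lemma inverse: "separated_codes n m r Q f' f"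
proof (intro separated_codes.intro separated_codes_axioms.intro)
  show "block_code n m r Q" by (rule block_code_axioms)
next
  fix x i s j s'
  assume x: "x \<in> full_shift n" and "occurs x i s" "occurs (f' x) j s'"
  then have "i - j \<notin> cube (l + q + r)"
    using apart[OF f'_in[OF x], of j s' i s] f_f'[OF x] by simp
  then show "j - i \<notin> cube (l + q + r)" by (simp add: cube_minus_commute)
qed (fact f_local f'_local f_in f'_in f_f' f'_f)+

lemma image_recolour_away:
  assumes x: "x \<in> full_shift n" and \<sigma>: "dom \<sigma> = dom (symbols x)"
    and u: "\<And>i. symbols x i \<noteq> None \<Longrightarrow> u - i \<notin> cube (q + r)"
  shows "f (recolour x \<sigma>) u = f x u"
proof (rule local_mapD[OF f_local recolour_in_full_shift[OF x] x], rule recolour_away, rule notI)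
  fix w i assume w: "w - u \<in> cube r" and i: "\<sigma> i \<noteq> None" "w - i \<in> cube q"
  then have "u - i \<in> cube (q + r)"
    using cube_diff_trans[of u w r i q "q + r"] by (simp add: cube_minus_commute)
  moreover have "symbols x i \<noteq> None" using i \<sigma> by (metis domIff)
  ultimately show False using u by blast
qed

text \<open>
  Rewriting cores in x changes f x only within distance r of these cores, where f x has no
  blocks.
\<close>

lemma occurs_image_recolour:
  assumes x: "x \<in> full_shift n" and \<sigma>: "dom \<sigma> = dom (symbols x)" and j: "occurs (f x) j s"
  shows "occurs (f (recolour x \<sigma>)) j s"
proof -
  have "f (recolour x \<sigma>) u = f x u" if u: "u - j \<in> cube l" for u
  proof (rule image_recolour_away[OF x \<sigma>], rule notI)
    fix i assume i: "symbols x i \<noteq> None" "u - i \<in> cube (q + r)"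
    then have "j - i \<in> cube (l + q + r)"
      using cube_diff_trans[of j u l i "q + r" "l + q + r"] u by (simp add: cube_minus_commute)
    then show False using apart[OF x _ j] i by (auto simp: symbols_eq_Some)
  qed
  then show ?thesis using j by (simp add: occurs_def)
qed

lemma symbols_image_recolour:
  assumes x: "x \<in> full_shift n" and \<sigma>: "compatible x \<sigma>"
  shows "symbols (f (recolour x \<sigma>)) = symbols (f x)"
proof -
  have d: "dom \<sigma> = dom (symbols x)" using \<sigma> by (simp add: compatible_def)
  have "occurs (f (recolour x \<sigma>)) j s \<longleftrightarrow> occurs (f x) j s" for j s
  proof
    assume "occurs (f (recolour x \<sigma>)) j s"
    then have "occurs (f (recolour (recolour x \<sigma>) (symbols x))) j s"
      by (rule occurs_image_recolour[OF recolour_in_full_shift[OF x], rotated])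
        (simp add: symbols_recolour x \<sigma> d)
    then show "occurs (f x) j s" by (simp add: recolour_recolour d recolour_symbols x)
  qed (rule occurs_image_recolour[OF x d])
  then have "occurs (f (recolour x \<sigma>)) = occurs (f x)" by (intro ext) simp
  then show ?thesis by (intro ext) (simp only: symbols_def)
qed

text \<open>
  Rewriting the blocks of f x alters x only near the blocks of f x, and rewriting the blocks of x
  alters f x only near the blocks of x. These regions are so far apart that at each site only one of the
  two operations is felt: the proof compares both sides near a core of f x, near a core of x, and away
  from both.
\<close>

lemma recolour_commute:
  assumes x: "x \<in> full_shift n" and \<sigma>: "compatible x \<sigma>" and \<rho>: "compatible (f x) \<rho>"
  shows "f (recolour (f' (recolour (f x) \<rho>)) \<sigma>) = recolour (f (recolour x \<sigma>)) \<rho>"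
proof
  fix u
  interpret inv: separated_codes n m r Q f' f by (rule inverse)
  define y where "y = recolour (f x) \<rho>"
  define x' where "x' = f' y"
  have fx: "f x \<in> full_shift n" using x by (rule f_in)
  have y: "y \<in> full_shift n" unfolding y_def using fx by (rule recolour_in_full_shift)
  have x': "x' \<in> full_shift n" unfolding x'_def using y by (rule f'_in)
  have fx': "f x' = y" by (simp add: x'_def f_f' y)
  have sx': "symbols x' = symbols x"
    using inv.symbols_image_recolour[OF fx \<rho>] f'_f[OF x] by (simp add: x'_def y_def)
  have d\<sigma>: "dom \<sigma> = dom (symbols x)" "dom \<sigma> = dom (symbols x')"
    and d\<rho>: "dom \<rho> = dom (symbols (f x))"
    using \<sigma> \<rho> sx' by (simp_all add: compatible_def)
  have \<sigma>': "compatible x' \<sigma>" using \<sigma> sx' by (simp add: compatible_def)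
  have s2: "symbols (f (recolour x \<sigma>)) = symbols (f x)"
    by (rule symbols_image_recolour[OF x \<sigma>])
  have far: False if "symbols x i \<noteq> None" "\<rho> j \<noteq> None" "j - i \<in> cube (l + q + r)" for i j
  proof -
    have "symbols (f x) j \<noteq> None" using that d\<rho> by (metis domIff)
    then show False using that apart[OF x] by (auto simp: symbols_eq_Some)
  qed
  have "f (recolour x' \<sigma>) u = recolour (f (recolour x \<sigma>)) \<rho> u"
  proof (cases "\<exists>j. \<rho> j \<noteq> None \<and> u - j \<in> cube q")
    case True
    then obtain j t where j: "\<rho> j = Some t" "u - j \<in> cube q" by blast
    have "compatible (f (recolour x \<sigma>)) \<rho>" using \<rho> s2 by (simp add: compatible_def)
    then have "recolour (f (recolour x \<sigma>)) \<rho> u = block t (u - j)"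
      using j by (intro recolour_near f_in recolour_in_full_shift x)
    also have "\<dots> = f x' u"
      unfolding fx' y_def using recolour_near[OF fx \<rho> j] by simp
    also have "\<dots> = f (recolour x' \<sigma>) u"
    proof (rule image_recolour_away[OF x' d\<sigma>(2), symmetric], rule notI)
      fix i assume i: "symbols x' i \<noteq> None" "u - i \<in> cube (q + r)"
      have "j - i \<in> cube (l + q + r)"
        using cube_diff_trans[of j u q i "q + r" "l + q + r"] i(2) j(2) sizes
        by (simp add: cube_minus_commute)
      then show False using far[of i j] i(1) j(1) sx' by auto
    qed
    finally show ?thesis by simp
  next
    case False
    then have away: "recolour z \<rho> u = z u" for z by (intro recolour_away) blast
    show ?thesis
    proof (cases "\<exists>i. symbols x i \<noteq> None \<and> u - i \<in> cube (q + r)")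
      case True
      then obtain i where i: "symbols x i \<noteq> None" "u - i \<in> cube (q + r)" by blast
      have "f (recolour x' \<sigma>) u = f (recolour x \<sigma>) u"
      proof (rule local_mapD[OF f_local recolour_in_full_shift[OF x'] recolour_in_full_shift[OF x]])
        fix w assume w: "w - u \<in> cube r"
        have "x' w = f' (f x) w"
          unfolding x'_def y_def
        proof (rule inv.image_recolour_away[OF fx d\<rho>], rule notI)
          fix j assume j: "symbols (f x) j \<noteq> None" "w - j \<in> cube (q + r)"
          have "j - u \<in> cube (q + 2 * r)"
            using cube_diff_trans[of j w "q + r" u r] w j(2) by (simp add: cube_minus_commute)
          then have "j - i \<in> cube (l + q + r)"
            using cube_diff_trans[of j u "q + 2 * r" i "q + r" "l + q + r"] i(2) sizes by simp
          moreover have "\<rho> j \<noteq> None" using j(1) d\<rho> by (metis domIff)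
          ultimately show False using far i(1) by blast
        qed
        then have "x' w = x w" using f'_f[OF x] by simp
        then show "recolour x' \<sigma> w = recolour x \<sigma> w" by (rule recolour_cong[OF refl])
      qed
      then show ?thesis by (simp add: away)
    next
      case False
      then have far_u: "u - i \<notin> cube (q + r)" if "symbols x i \<noteq> None" for i
        using that by blast
      have "f (recolour x' \<sigma>) u = f x' u"
        by (rule image_recolour_away[OF x' d\<sigma>(2)]) (simp only: sx' far_u not_False_eq_True)
      moreover have "f (recolour x \<sigma>) u = f x u"
        by (rule image_recolour_away[OF x d\<sigma>(1) far_u])
      ultimately show ?thesis using away fx' by (simp add: y_def)
    qed
  qed
  then show "f (recolour (f' (recolour (f x) \<rho>)) \<sigma>) u = recolour (f (recolour x \<sigma>)) \<rho> u"
    by (simp add: x'_def y_def)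
qed

end

section \<open>Stacks written on chains of blocks\<close>

text \<open>
  A stack is a list with its top at the head. Pushing a letter, or popping it if it is on top already,
  is left multiplication by a generator in the free product of three groups of order two, whose elements
  are the reduced lists.
\<close>

definition toggle_top :: "nat \<Rightarrow> nat list \<Rightarrow> nat list" where
  "toggle_top t w = (if w \<noteq> [] \<and> hd w = t then tl w else t # w)"

definition reduced :: "nat list \<Rightarrow> bool" where
  "reduced w \<longleftrightarrow> distinct_adj w \<and> set w \<subseteq> {1,2,3}"

lemma reduced_Nil: "reduced []"
  by (simp add: reduced_def)

lemma reduced_Cons:
  "reduced (a # w) \<longleftrightarrow> a \<in> {1,2,3} \<and> reduced w \<and> (w \<noteq> [] \<longrightarrow> hd w \<noteq> a)"
  by (auto simp: reduced_def distinct_adj_Cons)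

lemma reduced_toggle_top: "reduced w \<Longrightarrow> t \<in> {1,2,3} \<Longrightarrow> reduced (toggle_top t w)"
  by (cases w) (auto simp: toggle_top_def reduced_Cons)

text \<open>
  How a stack is laid out on a half-infinite tape: its bottom is at position 0, and blanks follow its
  top.
\<close>

definition letter :: "nat list \<Rightarrow> nat \<Rightarrow> nat" where
  "letter w j = (if j < length w then rev w ! j else 0)"

lemma letter_Nil: "letter [] j = 0"
  by (simp add: letter_def)

lemma letter_Cons:
  "letter (a # w) j = (if j < length w then letter w j else if j = length w then a else 0)"
  by (auto simp: letter_def nth_append)

lemma letter_nonzero: "reduced w \<Longrightarrow> letter w j \<noteq> 0 \<longleftrightarrow> j < length w"
proof (induction w)
  case (Cons a w)
  then show ?case by (auto simp: letter_Cons reduced_Cons)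
qed (simp add: letter_Nil)

lemma letter_inject:
  assumes "letter w = letter w'" "reduced w" "reduced w'"
  shows "w = w'"
proof -
  have iff: "j < length w \<longleftrightarrow> j < length w'" for j
    using letter_nonzero[OF assms(2), of j] letter_nonzero[OF assms(3), of j] assms(1) by simp
  have len: "length w = length w'"
    using iff[of "length w"] iff[of "length w'"] by simp
  have "rev w = rev w'"
  proof (rule nth_equalityI)
    fix j assume "j < length (rev w)"
    then show "rev w ! j = rev w' ! j"
      using fun_cong[OF assms(1), of j] len by (simp add: letter_def)
  qed (simp add: len)
  then show ?thesis by simp
qed

context block_code
begin

text \<open>
  Neighbouring blocks of a chain are a vector \<open>step\<close> apart; with 2 l + 1 in each
  coordinate they are disjoint.
\<close>

definition step :: "int ^ 'd" where "step = vec (2 * l + 1)"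

definition cell :: "nat \<Rightarrow> int ^ 'd" where "cell j = vec (int j * (2 * l + 1))"

lemma cell_simps: "cell 0 - step = - step" "cell (Suc j) - step = cell j" "cell j + step = cell (Suc j)"
  by (simp_all add: cell_def step_def vec_eq_iff algebra_simps)

text \<open>
  The symbol at i changes between blank and t when the right neighbour is blank or missing and the left
  neighbour is missing or carries a letter different from t. On a tape holding a stack this happens at one
  position only: directly after the top if the top differs from t, and at the top if it equals t. The
  conditions on the neighbours also make sense on arbitrary fields, where many positions may change at once.
\<close>

definition toggle :: "nat \<Rightarrow> (int ^ 'd \<Rightarrow> nat option) \<Rightarrow> int ^ 'd \<Rightarrow> nat option" where
  "toggle t \<sigma> i =
     (if \<sigma> i \<in> {Some 0, Some t} \<and> \<sigma> (i - step) \<notin> {Some 0, Some t} \<and> \<sigma> (i + step) \<in> {None, Some 0}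
      then if \<sigma> i = Some 0 then Some t else Some 0
      else \<sigma> i)"

text \<open>
  Two neighbouring positions never change together, since a position with a changing left neighbour sees
  0 or t on its left. Moreover a change stays inside the pair 0, t, so a position may change afterwards
  exactly if it could before.
\<close>

lemma toggle_toggle:
  assumes t: "t \<noteq> 0"
  shows "toggle t (toggle t \<sigma>) = \<sigma>"
proof
  fix i
  define flips where "flips i \<longleftrightarrow> \<sigma> i \<in> {Some 0, Some t} \<and> \<sigma> (i - step) \<notin> {Some 0, Some t}
    \<and> \<sigma> (i + step) \<in> {None, Some 0}" for i
  have tog: "toggle t \<sigma> i = (if flips i then if \<sigma> i = Some 0 then Some t else Some 0 else \<sigma> i)" for i
    by (simp add: toggle_def flips_def)
  have in_iff: "toggle t \<sigma> i \<in> {Some 0, Some t} \<longleftrightarrow> \<sigma> i \<in> {Some 0, Some t}" for i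
    unfolding tog flips_def by auto
  have right: "toggle t \<sigma> (i + step) = \<sigma> (i + step)" if "\<sigma> i \<in> {Some 0, Some t}"
    using that by (simp add: tog flips_def)
  show "toggle t (toggle t \<sigma>) i = \<sigma> i"
  proof (cases "\<sigma> i \<in> {Some 0, Some t}")
    case True
    then have "toggle t (toggle t \<sigma>) i = (if flips i
        then if toggle t \<sigma> i = Some 0 then Some t else Some 0 else toggle t \<sigma> i)"
      unfolding toggle_def[of t "toggle t \<sigma>"] in_iff right[OF True] flips_def by simp
    also have "\<dots> = \<sigma> i" using t True by (auto simp: tog flips_def)
    finally show ?thesis .
  next
    case False
    then have "toggle t \<sigma> i = \<sigma> i" by (simp add: tog flips_def)
    then show ?thesis using False by (simp add: toggle_def[of t "toggle t \<sigma>"])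
  qed
qed

definition stack_map :: "nat \<Rightarrow> (int ^ 'd \<Rightarrow> nat) \<Rightarrow> int ^ 'd \<Rightarrow> nat" where
  "stack_map t x = recolour x (toggle t (symbols x))"

lemma toggle_compatible:
  assumes t: "t \<in> {1,2,3}" and \<sigma>: "compatible x \<sigma>"
  shows "compatible x (toggle t \<sigma>)"
proof -
  have "toggle t \<sigma> i = None \<longleftrightarrow> \<sigma> i = None" for i by (auto simp: toggle_def)
  then have "dom (toggle t \<sigma>) = dom \<sigma>" by (simp add: dom_def)
  moreover have "s < 4" if "toggle t \<sigma> i = Some s" for i s
    using that t \<sigma> by (auto simp: toggle_def compatible_def ran_def split: if_splits)
  ultimately show ?thesis using \<sigma> by (auto simp: compatible_def ran_def)
qed

lemma stack_map_in: "x \<in> full_shift n \<Longrightarrow> stack_map t x \<in> full_shift n"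
  by (simp add: stack_map_def recolour_in_full_shift)

lemma symbols_stack_map:
  "x \<in> full_shift n \<Longrightarrow> t \<in> {1,2,3} \<Longrightarrow> symbols (stack_map t x) = toggle t (symbols x)"
  unfolding stack_map_def by (rule symbols_recolour[OF _ toggle_compatible[OF _ compatible_symbols]])

lemma stack_map_involution:
  assumes x: "x \<in> full_shift n" and t: "t \<in> {1,2,3}"
  shows "stack_map t (stack_map t x) = x"
proof -
  have t0: "t \<noteq> 0" using t by auto
  have d: "dom (toggle t (symbols x)) = dom (symbols x)"
    using toggle_compatible[OF t compatible_symbols, of x] by (simp add: compatible_def)
  have "stack_map t (stack_map t x) = recolour (stack_map t x) (toggle t (toggle t (symbols x)))"
    using symbols_stack_map[OF x t] by (simp add: stack_map_def[of t "stack_map t x"])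
  also have "\<dots> = recolour x (symbols x)"
    unfolding toggle_toggle[OF t0] unfolding stack_map_def by (rule recolour_recolour[OF d])
  finally show ?thesis using recolour_symbols[OF x] by simp
qed

lemma stack_map_local: "local_map n (q + 3 * l + 1) (stack_map t)"
  unfolding local_map_def
proof (intro ballI allI impI)
  fix x y :: "int ^ 'd \<Rightarrow> nat" and u assume eq: "\<forall>w. w - u \<in> cube (q + 3 * l + 1) \<longrightarrow> x w = y w"
  have sym: "symbols x i = symbols y i" if i: "i - u \<in> cube (q + 2 * l + 1)" for i
  proof (rule symbols_cong)
    fix w assume "w - i \<in> cube l"
    then have "w - u \<in> cube (q + 3 * l + 1)"
      using cube_diff_trans[OF _ i, of w l "q + 3 * l + 1"] by simp
    then show "x w = y w" using eq by blast
  qed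
  show "stack_map t x u = stack_map t y u"
    unfolding stack_map_def
  proof (rule recolour_cong)
    fix i assume "u - i \<in> cube q"
    then have i: "\<bar>i $ a - u $ a\<bar> \<le> q" for a
      by (simp add: cube_def abs_minus_commute)
    have "\<bar>i $ a - u $ a\<bar> \<le> q + 2 * l + 1 \<and> \<bar>i $ a - (2 * l + 1) - u $ a\<bar> \<le> q + 2 * l + 1
        \<and> \<bar>i $ a + (2 * l + 1) - u $ a\<bar> \<le> q + 2 * l + 1" for a
      using i[of a] sizes by linarith
    then have "i - u \<in> cube (q + 2 * l + 1)" "(i - step) - u \<in> cube (q + 2 * l + 1)"
      "(i + step) - u \<in> cube (q + 2 * l + 1)"
      by (simp_all add: cube_def step_def)
    then show "toggle t (symbols x) i = toggle t (symbols y) i"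
      by (simp add: toggle_def sym)
  next
    show "x u = y u" using eq sizes by (simp add: cube_def)
  qed
qed

lemma symbols_shift: "symbols (\<lambda>w. x (w + v)) i = symbols x (i + v)"
proof -
  have "occurs (\<lambda>w. x (w + v)) i s \<longleftrightarrow> occurs x (i + v) s" for s
  proof
    assume occ: "occurs (\<lambda>w. x (w + v)) i s"
    have "x u = block s (u - (i + v))" if "u - (i + v) \<in> cube l" for u
    proof -
      have "(u - v) - i \<in> cube l" using that by (simp add: algebra_simps)
      then have "x (u - v + v) = block s (u - v - i)" using occ unfolding occurs_def by blast
      then show ?thesis by (simp add: algebra_simps)
    qed
    then show "occurs x (i + v) s" using occ by (simp add: occurs_def)
  next
    assume occ: "occurs x (i + v) s"
    have "x (u + v) = block s (u - i)" if "u - i \<in> cube l" for u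
    proof -
      have "(u + v) - (i + v) \<in> cube l" using that by simp
      then have "x (u + v) = block s (u + v - (i + v))" using occ unfolding occurs_def by blast
      then show ?thesis by simp
    qed
    then show "occurs (\<lambda>w. x (w + v)) i s" using occ by (simp add: occurs_def)
  qed
  then have "occurs (\<lambda>w. x (w + v)) i = occurs x (i + v)" by (intro ext)
  then show ?thesis by (simp only: symbols_def)
qed

text \<open>
  The arbitrary choice in \<open>recolour\<close> need not respect translations, so the two sides are
  compared through the values that the blocks determine.
\<close>

lemma stack_map_shift:
  assumes x: "x \<in> full_shift n" and t: "t \<in> {1,2,3}"
  shows "stack_map t (\<lambda>w. x (w + v)) u = stack_map t x (u + v)"
proof -
  define y where "y = (\<lambda>w. x (w + v))"
  have y: "y \<in> full_shift n" using x by (simp add: y_def full_shift_iff)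
  have sy: "symbols y i = symbols x (i + v)" for i by (simp add: y_def symbols_shift)
  have ty: "toggle t (symbols y) i = toggle t (symbols x) (i + v)" for i
    by (simp add: toggle_def sy algebra_simps)
  note comp = toggle_compatible[OF t compatible_symbols]
  have "recolour y (toggle t (symbols y)) u = recolour x (toggle t (symbols x)) (u + v)"
  proof (cases "\<exists>i. toggle t (symbols y) i \<noteq> None \<and> u - i \<in> cube q")
    case True
    then obtain i s where i: "toggle t (symbols y) i = Some s" "u - i \<in> cube q" by blast
    have i': "toggle t (symbols x) (i + v) = Some s" "(u + v) - (i + v) \<in> cube q"
      using i by (simp_all add: ty)
    show ?thesis
      using recolour_near[OF y comp i] recolour_near[OF x comp i'] by simp
  next
    case False
    have "u + v - i \<notin> cube q" if "toggle t (symbols x) i \<noteq> None" for i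
    proof
      assume "u + v - i \<in> cube q"
      then have "u - (i - v) \<in> cube q" by (simp add: algebra_simps)
      moreover have "toggle t (symbols y) (i - v) \<noteq> None" using that by (simp add: ty)
      ultimately show False using False by blast
    qed
    then have "recolour x (toggle t (symbols x)) (u + v) = x (u + v)" by (rule recolour_away)
    moreover have "recolour y (toggle t (symbols y)) u = y u"
      using False by (intro recolour_away) blast
    ultimately show ?thesis by (simp add: y_def)
  qed
  then show ?thesis by (simp add: stack_map_def y_def)
qed

definition stack_aut :: "nat \<Rightarrow> (int ^ 'd \<Rightarrow> nat) \<Rightarrow> int ^ 'd \<Rightarrow> nat" where
  "stack_aut t = restrict (stack_map t) (full_shift n)"

lemma stack_aut_automorphism:
  assumes t: "t \<in> {1,2,3}"
  shows "stack_aut t \<in> shift_automorphisms n"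
proof -
  let ?T = "full_shift_topology n :: (int ^ 'd \<Rightarrow> nat) topology"
  have top: "topspace ?T = full_shift n" by (simp add: full_shift_def)
  have "continuous_map ?T ?T (stack_map t)"
    by (rule local_map_continuous[OF stack_map_local stack_map_in])
  then have "homeomorphic_maps ?T ?T (stack_map t) (stack_map t)"
    by (simp add: homeomorphic_maps_def top stack_map_involution[OF _ t])
  then have "homeomorphic_map ?T ?T (stack_map t)" by (rule homeomorphic_maps_imp_map)
  then have "homeomorphic_map ?T ?T (stack_aut t)"
    by (rule homeomorphic_map_eq) (simp add: stack_aut_def top)
  moreover have "compose (full_shift n) (stack_aut t) (shift n v)
      = compose (full_shift n) (shift n v) (stack_aut t)" for v
  proof
    fix x :: "int ^ 'd \<Rightarrow> nat"
    show "compose (full_shift n) (stack_aut t) (shift n v) x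
      = compose (full_shift n) (shift n v) (stack_aut t) x"
    proof (cases "x \<in> full_shift n")
      case True
      have "(\<lambda>u. x (u + v)) \<in> full_shift n" using True by (simp add: full_shift_iff)
      then show ?thesis
        using True stack_map_in[OF True] stack_map_shift[OF True t]
        by (auto simp: compose_eq shift_def stack_aut_def fun_eq_iff)
    qed (simp add: compose_def)
  qed
  ultimately show ?thesis
    by (auto simp: shift_automorphisms_def shifts_def stack_aut_def)
qed

definition holds_stack :: "(int ^ 'd \<Rightarrow> nat) \<Rightarrow> nat list \<Rightarrow> bool" where
  "holds_stack x w \<longleftrightarrow> reduced w \<and> symbols x (- step) = None \<and>
     (\<forall>j. symbols x (cell j) = Some (letter w j))"

lemma holds_stack_unique: "holds_stack x w \<Longrightarrow> holds_stack x w' \<Longrightarrow> w = w'"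
  unfolding holds_stack_def by (auto intro!: letter_inject)

text \<open>
  Reducedness is what makes a pop possible: the letter below the top differs from the top, so the
  condition on the left neighbour holds there.
\<close>

lemma holds_stack_toggle:
  assumes w: "holds_stack x w" and x: "x \<in> full_shift n" and t: "t \<in> {1,2,3}"
  shows "holds_stack (stack_map t x) (toggle_top t w)"
proof -
  let ?\<sigma> = "symbols x"
  have red: "reduced w" and base: "?\<sigma> (- step) = None" and cells: "\<And>j. ?\<sigma> (cell j) = Some (letter w j)"
    using w by (auto simp: holds_stack_def)
  have t0: "t \<noteq> 0" using t by auto
  have "toggle t ?\<sigma> (cell j) = Some (letter (toggle_top t w) j)" for j
  proof -
    have left: "?\<sigma> (cell j - step) \<notin> {Some 0, Some t} \<longleftrightarrow> j = 0 \<or> letter w (j - 1) \<notin> {0, t}"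
      by (cases j) (auto simp: cell_simps base cells)
    have tog: "toggle t ?\<sigma> (cell j) = Some
        (if letter w j \<in> {0, t} \<and> (j = 0 \<or> letter w (j - 1) \<notin> {0, t}) \<and> letter w (Suc j) = 0
         then if letter w j = 0 then t else 0 else letter w j)"
      unfolding toggle_def left cell_simps cells by auto
    show ?thesis
    proof (cases w)
      case Nil
      then show ?thesis unfolding tog by (auto simp: letter_Nil letter_Cons toggle_top_def)
    next
      case (Cons a w')
      have a: "a \<noteq> 0" and red': "reduced w'" and hd: "w' \<noteq> [] \<Longrightarrow> hd w' \<noteq> a"
        using red Cons by (auto simp: reduced_Cons)
      have nz: "letter w' j \<noteq> 0 \<longleftrightarrow> j < length w'" for j by (rule letter_nonzero[OF red'])
      have top: "letter w' (length w' - 1) = hd w'" if "w' \<noteq> []"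
        using that by (cases w') (auto simp: letter_Cons)
      consider "j < length w'" | "j = length w'" | "j = Suc (length w')" | "j > Suc (length w')" by linarith
      then show ?thesis
      proof cases
        case 1
        then have "letter w (Suc j) \<noteq> 0" using nz[of "Suc j"] a Cons by (auto simp: letter_Cons)
        then show ?thesis using 1 unfolding tog
          by (auto simp: Cons toggle_top_def letter_Cons)
      next
        case 2
        then show ?thesis unfolding tog using a t0 hd top nz[of "j - 1"] nz[of j]
          by (cases "w' = []") (auto simp: Cons toggle_top_def letter_Cons)
      next
        case 3
        then show ?thesis unfolding tog using a t0 nz[of j]
          by (auto simp: Cons toggle_top_def letter_Cons)
      next
        case 4
        then show ?thesis unfolding tog using a t0 nz[of j]
          by (auto simp: Cons toggle_top_def letter_Cons)
      qed
    qed
  qed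
  moreover have "toggle t ?\<sigma> (- step) = None" using base by (simp add: toggle_def)
  ultimately show ?thesis
    using reduced_toggle_top[OF red t] by (simp add: holds_stack_def symbols_stack_map[OF x t])
qed

text \<open>
  Blank blocks at the cells of a half-infinite chain, and zeros elsewhere. There is no block to the left
  of the chain because its corners would have to be nonzero.
\<close>

lemma empty_stack_exists: "\<exists>x\<in>full_shift n. holds_stack x []"
proof -
  define x where "x u = (if \<exists>j. u - cell j \<in> cube l then block 0 (u - cell (SOME j. u - cell j \<in> cube l)) else 0)" for u
  have x: "x \<in> full_shift n" using n by (simp add: full_shift_iff x_def block_less)
  have uniq: "i = j" if "u - cell i \<in> cube l" "u - cell j \<in> cube l" for u :: "int ^ 'd" and i j
  proof -
    have "\<bar>u $ a - int i * (2 * l + 1)\<bar> \<le> l" "\<bar>u $ a - int j * (2 * l + 1)\<bar> \<le> l" for a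
      using that by (auto simp: cube_def cell_def)
    from this[of undefined] have "\<bar>int i * (2 * l + 1) - int j * (2 * l + 1)\<bar> < 2 * l + 1" by linarith
    then have "\<bar>(int i - int j) * (2 * l + 1)\<bar> < 2 * l + 1" by (simp only: left_diff_distrib)
    moreover have "\<bar>2 * l + 1\<bar> = 2 * l + 1" using sizes by linarith
    ultimately have "\<bar>int i - int j\<bar> * (2 * l + 1) < 1 * (2 * l + 1)"
      by (simp only: abs_mult mult_1)
    then have "\<bar>int i - int j\<bar> < 1"
      by (rule mult_right_less_imp_less) (use sizes in linarith)
    then show ?thesis by simp
  qed
  have "occurs x (cell j) 0" for j
    unfolding occurs_def
  proof (intro conjI allI impI)
    fix u assume u: "u - cell j \<in> cube l"
    then have "(SOME j. u - cell j \<in> cube l) = j"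
      using uniq by (intro some_equality) auto
    then show "x u = block 0 (u - cell j)" using u by (auto simp: x_def)
  qed simp
  moreover have "\<not> occurs x (- step) s" for s
  proof
    assume occ: "occurs x (- step) s"
    define c :: "int ^ 'd" where "c = vec k"
    have c: "\<And>a. \<bar>c $ a\<bar> = k" using sizes by (simp add: c_def)
    have cl: "c \<in> cube l" using sizes by (simp add: c_def vec_in_cube)
    have e: "c - step - (- step) = c" by simp
    then have "x (c - step) = block s (c - step - (- step))"
      using occ cl unfolding occurs_def by simp
    then have "x (c - step) = block s c" unfolding e .
    then have 1: "x (c - step) = 1" using block_corner[OF c, of s] occ by (simp add: occurs_def)
    have "c - step - cell j \<notin> cube l" for j
    proof
      assume "c - step - cell j \<in> cube l"
      then have "\<bar>k - (2 * l + 1) - int j * (2 * l + 1)\<bar> \<le> l"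
        by (auto simp: cube_def c_def step_def cell_def)
      moreover have "0 \<le> int j * (2 * l + 1)" using sizes by simp
      ultimately show False using sizes by linarith
    qed
    then show False using 1 by (simp add: x_def)
  qed
  ultimately have "holds_stack x []"
    by (simp add: holds_stack_def reduced_Nil letter_Nil symbols_eq_None symbols_eq_Some)
  then show ?thesis using x by blast
qed

end

context separated_codes
begin

text \<open>
  Each of the two maps leaves unchanged the symbols that the other one reads, so both orders amount to the
  same two rewritings.
\<close>

lemma conjugate_stack_maps_commute:
  assumes y: "y \<in> full_shift n" and s: "s \<in> {1,2,3}" and t: "t \<in> {1,2,3}"
  shows "f (stack_map s (f' (stack_map t y))) = stack_map t (f (stack_map s (f' y)))"
proof -
  interpret inv: separated_codes n m r Q f' f by (rule inverse)
  define x where "x = f' y"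
  have x: "x \<in> full_shift n" and fx: "f x = y" using y by (simp_all add: x_def f'_in f_f')
  note comp = toggle_compatible[OF _ compatible_symbols]
  have "symbols (f' (stack_map t y)) = symbols x"
    unfolding stack_map_def x_def by (rule inv.symbols_image_recolour[OF y comp[OF t]])
  moreover have "symbols (f (stack_map s x)) = symbols y"
    unfolding stack_map_def using symbols_image_recolour[OF x comp[OF s]] fx by simp
  ultimately show ?thesis
    using recolour_commute[OF x comp[OF s], of "toggle t (symbols y)"] comp[OF t, of y] fx
    by (simp add: stack_map_def x_def)
qed

end

section \<open>Patterns that a non-shift does not translate\<close>

lemma nonshift_witness:
  fixes f :: "(int ^ 'd::finite \<Rightarrow> nat) \<Rightarrow> int ^ 'd \<Rightarrow> nat"
  assumes f: "f \<in> shift_automorphisms n" and v: "f \<noteq> shift n (- v)"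
  obtains x where "x \<in> full_shift n" "f x 0 \<noteq> x (- v)"
proof -
  have "\<exists>x\<in>full_shift n. f x \<noteq> shift n (- v) x"
  proof (rule ccontr)
    assume "\<not> ?thesis"
    then have "f = shift n (- v)"
      using f by (intro extensionalityI[of _ "full_shift n"]) (auto simp: shift_automorphisms_def shift_def)
    then show False using v by simp
  qed
  then obtain x u where x: "x \<in> full_shift n" "f x u \<noteq> x (u - v)"
    by (auto simp: shift_def fun_eq_iff)
  let ?y = "\<lambda>w. x (w + u)"
  have "?y \<in> full_shift n" using x by (simp add: full_shift_iff)
  moreover have "f ?y 0 \<noteq> ?y (- v)"
    using x automorphism_shift[OF f x(1), of u 0] by simp
  ultimately show ?thesis by (rule that)
qed

text \<open>
  For a single v, a failure of f to be the shift by -v is visible in a finite pattern. Since the full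
  shift imposes no restriction, such patterns for all v in a finite set can be placed side by side
  without interfering.
\<close>

lemma distinguishing_pattern:
  fixes f :: "(int ^ 'd::finite \<Rightarrow> nat) \<Rightarrow> int ^ 'd \<Rightarrow> nat"
  assumes f: "f \<in> shift_automorphisms n" "local_map n r f" "f \<notin> shifts n" and r: "0 \<le> r"
    and n: "0 < n" and V: "finite V" "V \<subseteq> cube r"
  shows "\<exists>m\<ge>0. \<exists>Q\<in>full_shift n. \<forall>v\<in>V. \<exists>c\<in>cube (m - r). c - v \<in> cube m \<and> f Q c \<noteq> Q (c - v)"
  using V
proof (induction V rule: finite_induct)
  case empty
  show ?case using n by (intro exI[of _ 0]) (auto simp: full_shift_iff intro!: exI[of _ "\<lambda>_. 0"])
next
  case (insert v V)
  then obtain m Q where m: "m \<ge> 0" and Q: "Q \<in> full_shift n"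
    and V: "\<And>v. v \<in> V \<Longrightarrow> \<exists>c\<in>cube (m - r). c - v \<in> cube m \<and> f Q c \<noteq> Q (c - v)"
    by auto
  have v: "v \<in> cube r" using insert.prems by simp
  have "f \<noteq> shift n (- v)" using f(3) by (auto simp: shifts_def)
  then obtain x where x: "x \<in> full_shift n" "f x 0 \<noteq> x (- v)"
    using nonshift_witness[OF f(1)] by blast
  \<comment> \<open>The new pattern is centred at t, so that its window of radius r is disjoint from the cube used so far.\<close>
  define t :: "int ^ 'd" where "t = vec (m + r + 1)"
  define R where "R u = (if u \<in> cube m then Q u else x (u - t))" for u
  have R: "R \<in> full_shift n" using Q x by (simp add: R_def full_shift_iff)
  have xt: "(\<lambda>u. x (u - t)) \<in> full_shift n" using x by (simp add: full_shift_iff)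
  have off: "w \<notin> cube m" if "w - t \<in> cube r" for w
  proof
    assume "w \<in> cube m"
    then have "\<bar>w $ a\<bar> \<le> m" "\<bar>w $ a - (m + r + 1)\<bar> \<le> r" for a
      using that by (auto simp: cube_def t_def)
    from this[of undefined] show False by linarith
  qed
  have "\<exists>c\<in>cube (m + 2 * r + 1 - r). c - v' \<in> cube (m + 2 * r + 1) \<and> f R c \<noteq> R (c - v')"
    if v': "v' \<in> insert v V" for v'
  proof (cases "v' = v")
    case True
    have "f R t = f (\<lambda>u. x (u - t)) t"
      using off by (intro local_mapD[OF f(2) R xt]) (simp add: R_def)
    also have "\<dots> = f x 0"
      using automorphism_shift[OF f(1) x(1), of "- t" t] by simp
    finally have "f R t = f x 0" .
    moreover have "(t - v) - t \<in> cube r" using v by (simp add: cube_def)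
    then have "R (t - v) = x (- v)" using off by (simp add: R_def)
    moreover have "t \<in> cube (m + 2 * r + 1 - r)" using m r by (simp add: t_def cube_def)
    moreover have "\<bar>(m + r + 1) - v $ a\<bar> \<le> m + 2 * r + 1" for a
    proof -
      have "\<bar>v $ a\<bar> \<le> r" using v by (simp add: cube_def)
      then show ?thesis using m by linarith
    qed
    then have "t - v \<in> cube (m + 2 * r + 1)" by (simp add: cube_def t_def)
    ultimately show ?thesis using True x by auto
  next
    case False
    then obtain c where c: "c \<in> cube (m - r)" "c - v' \<in> cube m" "f Q c \<noteq> Q (c - v')"
      using V v' by blast
    have "f R c = f Q c"
    proof (rule local_mapD[OF f(2) R Q])
      fix w assume w: "w - c \<in> cube r"
      have "w \<in> cube m"
        using cube_diff_trans[OF w, of 0 "m - r" m] c(1) by simp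
      then show "R w = Q w" by (simp add: R_def)
    qed
    then have "f R c \<noteq> R (c - v')" using c by (simp add: R_def)
    moreover have "c \<in> cube (m + 2 * r + 1 - r)" "c - v' \<in> cube (m + 2 * r + 1)"
      using c cube_mono[of c "m - r" "m + 2 * r + 1 - r"] cube_mono[of "c - v'" m "m + 2 * r + 1"] r by auto
    ultimately show ?thesis by blast
  qed
  then show ?case using m r R
    by (intro exI[of _ "m + 2 * r + 1"] conjI bexI[of _ R] ballI) auto
qed

text \<open>
  Either f moves the zero configuration, or the displacement is at most r. In the latter case
  the copies of Q at i in x and at j in f x would make f Q agree with the translate of Q by j - i at the
  site where \<open>bad\<close> says that they differ.
\<close>

lemma (in block_code) automorphism_blocks_apart:
  assumes f: "f \<in> shift_automorphisms n" "local_map n r f" and g: "local_map n r g"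
    and maps: "\<And>x. x \<in> full_shift n \<Longrightarrow> f x \<in> full_shift n"
    and gf: "\<And>x. x \<in> full_shift n \<Longrightarrow> g (f x) = x"
    and bad: "\<And>v. v \<in> cube r \<Longrightarrow> \<exists>c\<in>cube (m - r). c - v \<in> cube m \<and> f Q c \<noteq> Q (c - v)"
    and x: "x \<in> full_shift n" and occ: "occurs x i s" "occurs (f x) j s'"
  shows "j - i \<notin> cube (l + q + r)"
proof (cases "f (\<lambda>_. 0) 0 = 0")
  case False
  have "f (\<lambda>_. 0) u \<noteq> 0" for u
  proof -
    have "f (\<lambda>_. 0) 0 = f (\<lambda>_. 0) u"
      using automorphism_shift[OF f(1) zero_in_full_shift, of 0 u] by simp
    then show ?thesis using False by simp
  qed
  then show ?thesis by (rule no_near_occurrence_if_zero_moved[OF f(2) x _ occ])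
next
  case True
  then have z: "f (\<lambda>_. 0) u = 0" for u
    using automorphism_shift[OF f(1) zero_in_full_shift, of 0 u] by simp
  then have f0: "f (\<lambda>_. 0) = (\<lambda>_. 0)" by (intro ext)
  then have g0: "g (\<lambda>_. 0) u = 0" for u using gf[OF zero_in_full_shift] by simp
  show ?thesis
  proof
    assume "j - i \<in> cube (l + q + r)"
    then have "j - i \<in> cube r"
      using occurrence_displacement[OF f(2) g _ _ x maps[OF x] gf[OF x] z g0 occ] sizes by simp
    then obtain c where c: "c \<in> cube (m - r)" "c - (j - i) \<in> cube m" "f Q c \<noteq> Q (c - (j - i))"
      using bad by blast
    let ?y = "\<lambda>w. x (w + i)"
    have Q': "Q \<in> full_shift n" using Q by (simp add: full_shift_iff)
    have "f ?y c = f Q c"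
    proof (rule local_mapD[OF f(2) _ Q'])
      show "?y \<in> full_shift n" using x by (simp add: full_shift_iff)
      fix w assume w: "w - c \<in> cube r"
      have wm: "w \<in> cube m"
        using cube_diff_trans[OF w, of 0 "m - r" m] c(1) by simp
      then have "(w + i) - i \<in> cube l" using cube_mono[of w m l] sizes by simp
      then have "x (w + i) = block s (w + i - i)" using occ(1) unfolding occurs_def by blast
      then show "x (w + i) = Q w" using wm by (simp add: block_def)
    qed
    moreover have "f ?y c = f x (c + i)" by (rule automorphism_shift[OF f(1) x])
    moreover have "f x (c + i) = Q (c - (j - i))"
    proof -
      have e: "c + i - j = c - (j - i)" by simp
      have "c + i - j \<in> cube l" unfolding e using cube_mono[of "c - (j - i)" m l] c(2) sizes by simp
      then have "f x (c + i) = block s' (c + i - j)" using occ(2) unfolding occurs_def by blast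
      then show ?thesis unfolding e using c(2) by (simp add: block_def)
    qed
    ultimately show False using c(3) by simp
  qed
qed

section \<open>The group of stack automorphisms\<close>

lemma carrier_shift_aut_group: "carrier (shift_aut_group n) = shift_automorphisms n"
  by (simp add: shift_aut_group_def)

lemma automorphism_in_full_shift:
  "f \<in> shift_automorphisms n \<Longrightarrow> x \<in> full_shift n \<Longrightarrow> f x \<in> full_shift n"
  using subsetD[OF shift_automorphisms_subset_Bij, of f n] Bij_imp_funcset by blast

lemma mult_shift_aut_group:
  assumes "f \<in> shift_automorphisms n" "g \<in> shift_automorphisms n" "x \<in> full_shift n"
  shows "(f \<otimes>\<^bsub>shift_aut_group n\<^esub> g) x = f (g x)"
proof -
  have "f \<in> Bij (full_shift n)" "g \<in> Bij (full_shift n)"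
    using assms shift_automorphisms_subset_Bij by blast+
  then show ?thesis
    using assms by (simp add: shift_aut_group_def BijGroup_def compose_eq)
qed

lemma one_shift_aut_group: "x \<in> full_shift n \<Longrightarrow> \<one>\<^bsub>shift_aut_group n\<^esub> x = x"
  by (simp add: shift_aut_group_def BijGroup_def)

lemma automorphism_eqI:
  assumes "f \<in> shift_automorphisms n" "g \<in> shift_automorphisms n"
    and "\<And>x. x \<in> full_shift n \<Longrightarrow> f x = g x"
  shows "f = g"
  using assms by (intro extensionalityI[of _ "full_shift n"]) (auto simp: shift_automorphisms_def)

lemma inv_shift_aut_group:
  assumes f: "f \<in> shift_automorphisms n" and x: "x \<in> full_shift n"
  shows "inv\<^bsub>shift_aut_group n\<^esub> f \<in> shift_automorphisms n"
    and "(inv\<^bsub>shift_aut_group n\<^esub> f) (f x) = x" and "f ((inv\<^bsub>shift_aut_group n\<^esub> f) x) = x"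
proof -
  interpret G: group "shift_aut_group n" by (rule group_shift_aut_group)
  have fc: "f \<in> carrier (shift_aut_group n)" using f by (simp add: carrier_shift_aut_group)
  show i: "inv\<^bsub>shift_aut_group n\<^esub> f \<in> shift_automorphisms n"
    using G.inv_closed[OF fc] by (simp add: carrier_shift_aut_group)
  show "(inv\<^bsub>shift_aut_group n\<^esub> f) (f x) = x"
    using mult_shift_aut_group[OF i f x] G.l_inv[OF fc] one_shift_aut_group[OF x] by simp
  show "f ((inv\<^bsub>shift_aut_group n\<^esub> f) x) = x"
    using mult_shift_aut_group[OF f i x] G.r_inv[OF fc] one_shift_aut_group[OF x] by simp
qed

context block_code
begin

abbreviation "Aut \<equiv> shift_aut_group n :: ((int ^ 'd \<Rightarrow> nat) \<Rightarrow> int ^ 'd \<Rightarrow> nat) monoid"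

interpretation Aut: group Aut by (rule group_shift_aut_group)

lemma stack_aut_apply: "x \<in> full_shift n \<Longrightarrow> stack_aut t x = stack_map t x"
  by (simp add: stack_aut_def)

lemma stack_aut_carrier: "t \<in> {1,2,3} \<Longrightarrow> stack_aut t \<in> carrier Aut"
  using stack_aut_automorphism carrier_shift_aut_group by blast

lemma inv_stack_aut:
  assumes t: "t \<in> {1,2,3}"
  shows "inv\<^bsub>Aut\<^esub> (stack_aut t) = stack_aut t"
proof (rule Aut.inv_equality)
  note tc = stack_aut_carrier[OF t]
  show "stack_aut t \<otimes>\<^bsub>Aut\<^esub> stack_aut t = \<one>\<^bsub>Aut\<^esub>"
  proof (rule automorphism_eqI)
    show "stack_aut t \<otimes>\<^bsub>Aut\<^esub> stack_aut t \<in> shift_automorphisms n" "\<one>\<^bsub>Aut\<^esub> \<in> shift_automorphisms n"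
      using Aut.m_closed[OF tc tc] Aut.one_closed by (simp_all only: carrier_shift_aut_group)
  qed (simp add: mult_shift_aut_group stack_aut_automorphism[OF t] one_shift_aut_group
      stack_aut_apply stack_map_in stack_map_involution[OF _ t])
qed (use stack_aut_carrier[OF t] in auto)

definition stack_group :: "((int ^ 'd \<Rightarrow> nat) \<Rightarrow> int ^ 'd \<Rightarrow> nat) set" where
  "stack_group = generate Aut (stack_aut ` {1,2,3})"

lemma stack_group_subgroup: "subgroup stack_group Aut"
  unfolding stack_group_def using stack_aut_carrier by (intro Aut.generate_is_subgroup) blast

lemma stack_aut_in_stack_group: "t \<in> {1,2,3} \<Longrightarrow> stack_aut t \<in> stack_group"
  unfolding stack_group_def by (intro generate.incl) blast

lemma stack_group_holds_stack:
  assumes "g \<in> stack_group" "x \<in> full_shift n" "holds_stack x w"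
  shows "\<exists>w'. holds_stack (g x) w'"
  using assms unfolding stack_group_def
proof (induction g arbitrary: x w rule: generate.induct)
  case one
  then show ?case using one_shift_aut_group by metis
next
  case (incl h)
  then show ?case using holds_stack_toggle stack_aut_apply by fastforce
next
  case (inv h)
  then show ?case using holds_stack_toggle stack_aut_apply inv_stack_aut by fastforce
next
  case (eng h1 h2)
  have h: "h1 \<in> shift_automorphisms n" "h2 \<in> shift_automorphisms n"
    using eng.hyps subgroup.subset[OF stack_group_subgroup]
    by (auto simp: stack_group_def carrier_shift_aut_group)
  obtain w' where w': "holds_stack (h2 x) w'" using eng.IH(2)[OF eng.prems] by blast
  have "h2 x \<in> full_shift n" by (rule automorphism_in_full_shift[OF h(2) eng.prems(1)])
  then show ?case using eng.IH(1)[OF _ w'] mult_shift_aut_group[OF h eng.prems(1)] by simp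
qed

definition conj_stack :: "nat \<Rightarrow> nat \<Rightarrow> (int ^ 'd \<Rightarrow> nat) \<Rightarrow> int ^ 'd \<Rightarrow> nat" where
  "conj_stack s t = stack_aut s \<otimes>\<^bsub>Aut\<^esub> stack_aut t \<otimes>\<^bsub>Aut\<^esub> stack_aut s"

lemma conj_stack_in_stack_group:
  "s \<in> {1,2,3} \<Longrightarrow> t \<in> {1,2,3} \<Longrightarrow> conj_stack s t \<in> stack_group"
  unfolding conj_stack_def
  by (intro subgroup.m_closed[OF stack_group_subgroup] stack_aut_in_stack_group)

definition stack_commutator :: "nat \<Rightarrow> nat \<Rightarrow> nat \<Rightarrow> (int ^ 'd \<Rightarrow> nat) \<Rightarrow> int ^ 'd \<Rightarrow> nat" where
  "stack_commutator s t u = conj_stack s t \<otimes>\<^bsub>Aut\<^esub> conj_stack s u \<otimes>\<^bsub>Aut\<^esub>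
     inv\<^bsub>Aut\<^esub> conj_stack s t \<otimes>\<^bsub>Aut\<^esub> inv\<^bsub>Aut\<^esub> conj_stack s u"

lemma stack_commutator_in_stack_group:
  assumes "s \<in> {1,2,3}" "t \<in> {1,2,3}" "u \<in> {1,2,3}"
  shows "stack_commutator s t u \<in> stack_group"
  unfolding stack_commutator_def using assms
  by (intro subgroup.m_closed[OF stack_group_subgroup] subgroup.m_inv_closed[OF stack_group_subgroup]
      conj_stack_in_stack_group)

lemma conj_stack_apply:
  assumes "s \<in> {1,2,3}" "t \<in> {1,2,3}" and x: "x \<in> full_shift n"
  shows "conj_stack s t x = stack_map s (stack_map t (stack_map s x))"
proof -
  have "stack_aut s \<otimes>\<^bsub>Aut\<^esub> stack_aut t \<in> shift_automorphisms n"
    using Aut.m_closed[OF stack_aut_carrier stack_aut_carrier] assms by (simp only: carrier_shift_aut_group)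
  then show ?thesis
    using assms unfolding conj_stack_def
    by (simp add: mult_shift_aut_group stack_aut_automorphism stack_aut_apply stack_map_in)
qed

text \<open>
  The conjugates sts and sus are involutions, so their commutator is sts sus sts sus, which
  cancels to stutus.
\<close>

lemma stack_commutator_apply:
  assumes s: "s \<in> {1,2,3}" and t: "t \<in> {1,2,3}" and u: "u \<in> {1,2,3}" and x: "x \<in> full_shift n"
  shows "stack_commutator s t u x =
    stack_map s (stack_map t (stack_map u (stack_map t (stack_map u (stack_map s x)))))"
proof -
  have inv: "inv\<^bsub>Aut\<^esub> conj_stack s a = conj_stack s a" if "a \<in> {1,2,3}" for a
    using stack_aut_carrier[OF s] stack_aut_carrier[OF that]
    by (simp add: conj_stack_def Aut.inv_mult_group inv_stack_aut[OF s] inv_stack_aut[OF that] Aut.m_assoc)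
  have c: "conj_stack s a \<in> carrier Aut" if "a \<in> {1,2,3}" for a
    using conj_stack_in_stack_group[OF s that] subgroup.subset[OF stack_group_subgroup] by blast
  have "stack_commutator s t u x = conj_stack s t (conj_stack s u (conj_stack s t (conj_stack s u x)))"
    unfolding stack_commutator_def inv[OF t] inv[OF u]
    using c[OF t] c[OF u] Aut.m_closed x
    by (simp add: mult_shift_aut_group automorphism_in_full_shift flip: carrier_shift_aut_group)
  then show ?thesis
    using s t u x by (simp add: conj_stack_apply stack_map_in stack_map_involution)
qed

lemma stack_commutator_pushes:
  assumes s: "s \<in> {1,2,3}" and t: "t \<in> {1,2,3}" and u: "u \<in> {1,2,3}"
    and neq: "s \<noteq> t" "t \<noteq> u" "u \<noteq> s"
    and x: "x \<in> full_shift n" and w: "holds_stack x w" "w = [] \<or> hd w \<noteq> s"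
  shows "holds_stack (stack_commutator s t u x) (s # t # u # t # u # s # w)"
proof -
  have "holds_stack (stack_commutator s t u x)
     (toggle_top s (toggle_top t (toggle_top u (toggle_top t (toggle_top u (toggle_top s w))))))"
    unfolding stack_commutator_apply[OF s t u x]
    by (intro holds_stack_toggle stack_map_in x w s t u)
  then show ?thesis using neq w(2) by (auto simp: toggle_top_def)
qed

text \<open>
  The elements of the stack group are sorted by the top letter of the stack that they produce from the
  empty one; the commutators then satisfy the hypotheses of the ping-pong lemma.
\<close>

lemma amenable_subgroup_misses_stack_commutators:
  assumes N: "subgroup N Aut" and am: "amenable (Aut\<lparr>carrier := N\<rparr>)"
    and comm: "\<And>s t u. {s, t, u} \<subseteq> {1,2,3} \<Longrightarrow> stack_commutator s t u \<in> N"
  shows False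
proof -
  obtain x where x: "x \<in> full_shift n" "holds_stack x []" using empty_stack_exists by blast
  \<comment> \<open>The other two letters, in increasing order.\<close>
  define k where "k s = stack_commutator s (if s = 1 then 2 else 1) (if s = 3 then 2 else 3)" for s :: nat
  define P where "P s = {g \<in> stack_group. \<exists>w. holds_stack (g x) w \<and> w \<noteq> [] \<and> hd w = s}" for s
  show False
  proof (rule Aut.amenable_no_ping_pong[OF N am stack_group_subgroup, of "{1,2,3 :: nat}" k P])
    show "k s \<in> N \<inter> stack_group" if "s \<in> {1,2,3}" for s
      using that unfolding k_def by (auto intro!: comm stack_commutator_in_stack_group)
  next
    fix s g assume s: "s \<in> {1,2,3 :: nat}" and g: "g \<in> stack_group" "g \<notin> P s"
    have ks: "k s \<in> stack_group"
      using s unfolding k_def by (auto intro!: stack_commutator_in_stack_group)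
    have auts: "k s \<in> shift_automorphisms n" "g \<in> shift_automorphisms n"
      using ks g(1) subgroup.subset[OF stack_group_subgroup] by (auto simp: carrier_shift_aut_group)
    obtain w where w: "holds_stack (g x) w" using stack_group_holds_stack[OF g(1) x] by blast
    then have w': "w = [] \<or> hd w \<noteq> s" using g unfolding P_def by blast
    have gx: "g x \<in> full_shift n" by (rule automorphism_in_full_shift[OF auts(2) x(1)])
    define t u :: nat where "t = (if s = 1 then 2 else 1)" and "u = (if s = 3 then 2 else 3)"
    then have tu: "t \<in> {1,2,3}" "u \<in> {1,2,3}" "s \<noteq> t" "t \<noteq> u" "u \<noteq> s" "k s = stack_commutator s t u"
      using s by (auto simp: k_def)
    have "holds_stack (k s (g x)) (s # t # u # t # u # s # w)"
      unfolding tu(6) by (rule stack_commutator_pushes[OF s tu(1-5) gx w w'])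
    then obtain w'' where "holds_stack ((k s \<otimes>\<^bsub>Aut\<^esub> g) x) (s # w'')"
      using mult_shift_aut_group[OF auts x(1)] by auto
    moreover have "k s \<otimes>\<^bsub>Aut\<^esub> g \<in> stack_group"
      by (rule subgroup.m_closed[OF stack_group_subgroup ks g(1)])
    ultimately show "k s \<otimes>\<^bsub>Aut\<^esub> g \<in> P s" unfolding P_def by fastforce
  next
    fix s t :: nat assume "s \<noteq> t"
    then show "P s \<inter> P t = {}" unfolding P_def by (auto dest: holds_stack_unique)
  qed auto
qed

end

theorem theorem1p3:
  fixes n :: nat
    and N :: "((int ^ 'd::finite \<Rightarrow> nat) \<Rightarrow> (int ^ 'd \<Rightarrow> nat)) set"
  assumes "n \<ge> 2"
    and "normal N (shift_aut_group n)"
    and "amenable ((shift_aut_group n)\<lparr>carrier := N\<rparr>)"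
  shows "N \<subseteq> shifts n"
proof (rule subsetI, rule ccontr)
  fix f assume fN: "f \<in> N" and nonshift: "f \<notin> shifts n"
  let ?G = "shift_aut_group n :: ((int ^ 'd \<Rightarrow> nat) \<Rightarrow> (int ^ 'd \<Rightarrow> nat)) monoid"
  interpret G: group ?G by (rule group_shift_aut_group)
  interpret N: normal N ?G by fact
  define f' where "f' = inv\<^bsub>?G\<^esub> f"
  have fc: "f \<in> carrier ?G" using fN N.subset by blast
  then have f: "f \<in> shift_automorphisms n" by (simp add: carrier_shift_aut_group)
  have f'c: "f' \<in> carrier ?G" unfolding f'_def using fc by simp
  then have f': "f' \<in> shift_automorphisms n" by (simp add: carrier_shift_aut_group)
  obtain r1 r2 where "0 \<le> r1" "local_map n r1 f" "0 \<le> r2" "local_map n r2 f'"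
    using automorphism_local_map[OF f] automorphism_local_map[OF f'] by blast
  then obtain r where radius: "0 \<le> r" "local_map n r f" "local_map n r f'"
    using local_map_mono[of n r1 f "max r1 r2"] local_map_mono[of n r2 f' "max r1 r2"]
    by (metis max.cobounded1 max.cobounded2 max.coboundedI1)
  \<comment> \<open>The vectors of length at most the radius are those that the landmarks of a block leave open.\<close>
  obtain m Q where m: "m \<ge> 0" and Q: "Q \<in> full_shift n"
    and bad: "\<And>v. v \<in> cube r \<Longrightarrow> \<exists>c\<in>cube (m - r). c - v \<in> cube m \<and> f Q c \<noteq> Q (c - v)"
    using distinguishing_pattern[OF f radius(2) nonshift radius(1) _ finite_cube subset_refl] assms(1) by auto
  interpret block_code n m r Q
    using assms(1) m radius(1) Q by unfold_locales (simp_all add: full_shift_iff)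
  interpret separated_codes n m r Q f f'
  proof unfold_locales
    show "j - i \<notin> cube (l + q + r)"
      if "x \<in> full_shift n" "occurs x i s" "occurs (f x) j s'" for x i s j s'
      using that bad radius f'_def
      by (intro automorphism_blocks_apart[OF f radius(2,3)] automorphism_in_full_shift[OF f])
        (auto simp: inv_shift_aut_group f)
  qed (auto simp: radius(1,2) f'_def inv_shift_aut_group[OF f] intro: automorphism_in_full_shift f f'[unfolded f'_def] radius(3)[unfolded f'_def])
  \<comment> \<open>It suffices to compare generators: commutation passes to products on either side.\<close>
  have base: "(f \<otimes>\<^bsub>?G\<^esub> stack_aut s \<otimes>\<^bsub>?G\<^esub> inv\<^bsub>?G\<^esub> f) \<otimes>\<^bsub>?G\<^esub> stack_aut t
      = stack_aut t \<otimes>\<^bsub>?G\<^esub> (f \<otimes>\<^bsub>?G\<^esub> stack_aut s \<otimes>\<^bsub>?G\<^esub> inv\<^bsub>?G\<^esub> f)"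
    if s: "s \<in> {1,2,3}" and t: "t \<in> {1,2,3}" for s t
  proof (rule automorphism_eqI)
    note sc = stack_aut_carrier[OF s] and tc = stack_aut_carrier[OF t]
    have fs: "f \<otimes>\<^bsub>?G\<^esub> stack_aut s \<in> carrier ?G" using fc sc by simp
    then have fsf: "f \<otimes>\<^bsub>?G\<^esub> stack_aut s \<otimes>\<^bsub>?G\<^esub> f' \<in> carrier ?G" using f'c by simp
    note closed = f f' stack_aut_automorphism[OF s] stack_aut_automorphism[OF t]
      fs[unfolded carrier_shift_aut_group] fsf[unfolded carrier_shift_aut_group]
    show "(f \<otimes>\<^bsub>?G\<^esub> stack_aut s \<otimes>\<^bsub>?G\<^esub> inv\<^bsub>?G\<^esub> f) \<otimes>\<^bsub>?G\<^esub> stack_aut t \<in> shift_automorphisms n"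
      "stack_aut t \<otimes>\<^bsub>?G\<^esub> (f \<otimes>\<^bsub>?G\<^esub> stack_aut s \<otimes>\<^bsub>?G\<^esub> inv\<^bsub>?G\<^esub> f) \<in> shift_automorphisms n"
      using G.m_closed[OF fsf tc] G.m_closed[OF tc fsf]
      unfolding f'_def carrier_shift_aut_group by simp_all
    fix x :: "int ^ 'd \<Rightarrow> nat" assume x: "x \<in> full_shift n"
    show "((f \<otimes>\<^bsub>?G\<^esub> stack_aut s \<otimes>\<^bsub>?G\<^esub> inv\<^bsub>?G\<^esub> f) \<otimes>\<^bsub>?G\<^esub> stack_aut t) x
      = (stack_aut t \<otimes>\<^bsub>?G\<^esub> (f \<otimes>\<^bsub>?G\<^esub> stack_aut s \<otimes>\<^bsub>?G\<^esub> inv\<^bsub>?G\<^esub> f)) x"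
      using conjugate_stack_maps_commute[OF x s t]
      by (simp add: mult_shift_aut_group closed x stack_aut_apply stack_map_in f_in f'_in flip: f'_def)
  qed
  have "stack_commutator s t u \<in> N" if stu: "{s, t, u} \<subseteq> {1,2,3}" for s t u
  proof -
    have s: "s \<in> {1,2,3}" and t: "t \<in> {1,2,3}" and u: "u \<in> {1,2,3}" using stu by auto
    note car = stack_aut_carrier[OF s] stack_aut_carrier[OF t] stack_aut_carrier[OF u]
    have 1: "(f \<otimes>\<^bsub>?G\<^esub> conj_stack s t \<otimes>\<^bsub>?G\<^esub> inv\<^bsub>?G\<^esub> f) \<otimes>\<^bsub>?G\<^esub> stack_aut a
      = stack_aut a \<otimes>\<^bsub>?G\<^esub> (f \<otimes>\<^bsub>?G\<^esub> conj_stack s t \<otimes>\<^bsub>?G\<^esub> inv\<^bsub>?G\<^esub> f)"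
      if a: "a \<in> {1,2,3}" for a
      unfolding conj_stack_def
      by (intro G.conjugates_commute_mult base s t a fc stack_aut_carrier G.m_closed)
    have cc: "conj_stack s t \<in> carrier ?G" "conj_stack s u \<in> carrier ?G"
      using car by (simp_all add: conj_stack_def)
    define h where "h = f \<otimes>\<^bsub>?G\<^esub> conj_stack s t \<otimes>\<^bsub>?G\<^esub> inv\<^bsub>?G\<^esub> f"
    have h: "h \<in> carrier ?G" unfolding h_def using fc cc by simp
    have "conj_stack s u \<otimes>\<^bsub>?G\<^esub> h = h \<otimes>\<^bsub>?G\<^esub> conj_stack s u"
      unfolding conj_stack_def
      by (intro G.commute_mult G.m_closed car h 1[OF s, folded h_def, symmetric] 1[OF u, folded h_def, symmetric])
    then show ?thesis
      unfolding stack_commutator_def using h_def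
      by (intro G.commutator_in_normal[OF assms(2) fN cc]) simp
  qed
  then show False
    by (rule amenable_subgroup_misses_stack_commutators[OF N.is_subgroup assms(3)])
qed

end
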